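(* Let $n\ge 1$ be an integer. If $E\subset\mathbb{T}^n$ is compact and $C(E)=0$, then there exists a function $f\in\mathcal{D}(\mathbb{D}^n)$, $f(\theta)\sim\sum_{\alpha\in\mathbb{N}^n}a_\alpha e^{i(\alpha,\theta)}$, such that the series $f(\theta)$ diverges in the sense of Pringsheim for every $\theta\in E$.
   Context: Notation: $\mathbb{N}=\{0,1,2,\dots\}$; $(\alpha,\theta)=\alpha_1\theta_1+\cdots+\alpha_n\theta_n$. The set $[0,2\pi)^n$ is identified with the $n$-torus $\mathbb{T}^n$ via $\theta\mapsto(e^{i\theta_1},\dots,e^{i\theta_n})$ (with the topology of $\mathbb{T}^n$), and $d\psi$ denotes normalized Lebesgue measure on $\mathbb{T}^n$. Dirichlet space: a multiple Fourier series $f(\theta)\sim\sum_{\alpha\in\mathbb{N}^n}a_\alpha e^{i(\alpha,\theta)}$ with coefficients $a_\alpha\in\mathbb{C}$ belongs to $\mathcal{D}(\mathbb{D}^n)$ if $\sum_{\alpha\in\mathbb{N}^n}(\alpha_1+1)\cdots(\alpha_n+1)|a_\alpha|^2<\infty$. Capacity: for a positive measurable function $g$ on $\mathbb{T}^n$ let $$Bg(\theta)=\int_{\mathbb{T}^n}\frac{1}{|e^{i\theta_1}-e^{i\psi_1}|^{1/2}}\cdots\frac{1}{|e^{i\theta_n}-e^{i\psi_n}|^{1/2}}\,g(\psi)\,d\psi\in[0,\infty].$$ For a set $E\subset\mathbb{T}^n$ let $C(E)=\inf\{\|g\|_{L^2(\mathbb{T}^n)}^2 : g\ge 0,\ Bg(\theta)\ge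 1 \text{ for all } \theta\in E\}$. Pringsheim convergence: the series $f(\theta)$ converges in the sense of Pringsheim (at the given $\theta$) if the rectangular partial sums $\sum_{\alpha_1=0}^{N_1}\cdots\sum_{\alpha_n=0}^{N_n}a_\alpha e^{i(\alpha,\theta)}$ converge in $\mathbb{C}$ as $N\in\mathbb{N}^n$, $N\to\infty$, where $N\to\infty$ means $\min_{1\le j\le n}N_j\to\infty$ with no assumption on the relationship between the $N_j$, and in addition $\sup_{N\in\mathbb{N}^n}\bigl|\sum_{\alpha_1=0}^{N_1}\cdots\sum_{\alpha_n=0}^{N_n}a_\alpha e^{i(\alpha,\theta)}\bigr|<\infty$. The series diverges in the sense of Pringsheim at $\theta$ if it does not converge in the sense of Pringsheim at $\theta$. *)

theory Defs
  imports "HOL-Analysis.Analysis"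
begin

text \<open>
  The dimension \<open>n \<ge> 1\<close> is the cardinality of the finite index type \<open>'n\<close>.  The torus is
  represented by its angular coordinates in \<open>[0, 2 pi)^n\<close>; its topology is not the one inherited
  from the Euclidean space of angles, but the one transported by \<open>torus_map\<close>.
\<close>

definition torus :: "(real ^ 'n) set" where
  "torus = {\<theta>. \<forall>j. 0 \<le> \<theta> $ j \<and> \<theta> $ j < 2 * pi}"

definition torus_map :: "real ^ 'n \<Rightarrow> complex ^ 'n" where
  "torus_map \<theta> = (\<chi> j. cis (\<theta> $ j))"

definition torus_compact :: "(real ^ 'n) set \<Rightarrow> bool" where
  "torus_compact E \<longleftrightarrow> E \<subseteq> torus \<and> compact (torus_map ` E)"

definition torus_measure :: "(real ^ 'n) measure" where
  "torus_measure = uniform_measure (lebesgue_on torus) torus"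

text \<open>
  The kernel is taken in \<open>ennreal\<close>, where \<open>1 / 0 = \<infinity>\<close>.
\<close>

definition potential :: "(real ^ 'n \<Rightarrow> real) \<Rightarrow> real ^ 'n \<Rightarrow> ennreal" where
  "potential g \<theta> =
     (\<integral>\<^sup>+ \<psi>. (\<Prod>j\<in>UNIV. 1 / ennreal (sqrt (cmod (cis (\<theta> $ j) - cis (\<psi> $ j))))) * ennreal (g \<psi>)
        \<partial>torus_measure)"

definition capacity :: "(real ^ 'n) set \<Rightarrow> ennreal" where
  "capacity E =
     (INF g \<in> {g. g \<in> borel_measurable torus_measure \<and> (\<forall>\<psi>\<in>torus. 0 \<le> g \<psi>) \<and>
                  (\<forall>\<theta>\<in>E. 1 \<le> potential g \<theta>)}.
        \<integral>\<^sup>+ \<psi>. ennreal ((g \<psi>)\<^sup>2) \<partial>torus_measure)"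

definition fourier_coeff :: "(real ^ 'n \<Rightarrow> complex) \<Rightarrow> ('n \<Rightarrow> int) \<Rightarrow> complex" where
  "fourier_coeff f k =
     (LINT \<theta>|torus_measure. f \<theta> * cis (- (\<Sum>j\<in>UNIV. of_int (k j) * \<theta> $ j)))"

text \<open>
  The relation \<open>f ~ (\<Sum>\<alpha>. a \<alpha> * exp (\<i> * (\<alpha>, \<theta>)))\<close>, with \<open>\<alpha>\<close> ranging over tuples of natural
  numbers: the Fourier coefficients of \<open>f\<close> at all other integer frequencies vanish.
\<close>

definition has_fourier_series ::
    "(real ^ 'n \<Rightarrow> complex) \<Rightarrow> (('n \<Rightarrow> nat) \<Rightarrow> complex) \<Rightarrow> bool" where
  "has_fourier_series f a \<longleftrightarrow>
     integrable torus_measure f \<and>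
     (\<forall>k. fourier_coeff f k = (if \<forall>j. 0 \<le> k j then a (\<lambda>j. nat (k j)) else 0))"

definition dirichlet_coeffs :: "(('n::finite \<Rightarrow> nat) \<Rightarrow> complex) \<Rightarrow> bool" where
  "dirichlet_coeffs a \<longleftrightarrow>
     (\<lambda>\<alpha>. (\<Prod>j\<in>UNIV. real (\<alpha> j) + 1) * (cmod (a \<alpha>))\<^sup>2) summable_on UNIV"

definition dirichlet_space :: "(real ^ 'n \<Rightarrow> complex) set" where
  "dirichlet_space = {f. \<exists>a. has_fourier_series f a \<and> dirichlet_coeffs a}"

definition rect_partial_sum ::
    "(('n \<Rightarrow> nat) \<Rightarrow> complex) \<Rightarrow> real ^ 'n \<Rightarrow> ('n \<Rightarrow> nat) \<Rightarrow> complex" where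
  "rect_partial_sum a \<theta> N =
     (\<Sum>\<alpha> | \<forall>j. \<alpha> j \<le> N j. a \<alpha> * cis (\<Sum>j\<in>UNIV. real (\<alpha> j) * \<theta> $ j))"

text \<open>
  Convergence in the sense of Pringsheim includes boundedness of all rectangular partial sums,
  which does not follow from the existence of the limit when \<open>n \<ge> 2\<close>.
\<close>

definition pringsheim_convergent :: "(('n::finite \<Rightarrow> nat) \<Rightarrow> complex) \<Rightarrow> real ^ 'n \<Rightarrow> bool" where
  "pringsheim_convergent a \<theta> \<longleftrightarrow>
     (\<exists>l. (rect_partial_sum a \<theta> \<longlongrightarrow> l) (filtercomap (\<lambda>N. Min (range N)) at_top)) \<and>
     bounded (range (rect_partial_sum a \<theta>))"

end

theory Submission
  imports Defs
begin

text \<open>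
  By duality, a set of capacity zero carries no measure of finite energy. The analytic half
  \<open>k\<close> of the one-variable energy kernel has a large real part and a bounded imaginary part, so
  that after adding a constant to \<open>k\<close> the product \<open>\<Prod>j. k (t j)\<close> has argument close to \<open>0\<close>: the
  energy restricted to frequencies in \<open>\<nat>\<^sup>n\<close> dominates the full energy. (The kernel
  \<open>(1 - z) powr (-1/2)\<close> itself does not have this property when \<open>n \<ge> 2\<close>.) Hence the analytic energy
  of probability measures on \<open>E\<close> is large, and the potential of a near minimizer, suitably scaled,
  is a polynomial of small Dirichlet norm whose real part is at least \<open>1\<close> on \<open>E\<close>. Such
  polynomials, shifted to pairwise disjoint blocks of frequencies along the diagonal, sum to a
  function of the Dirichlet space; the difference of two consecutive cubic partial sums is one
  block, of modulus at least \<open>1\<close> on \<open>E\<close>. A shift by \<open>s\<close> costs only a factor \<open>(s + 1)\<^sup>n\<close>, so the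
  norms of the blocks can be chosen after the shifts.
\<close>

subsection \<open>Integration over the torus\<close>

text \<open>Two choices keep the duality elementary. The kernel is regularized at a radius
  \<open>r < 1\<close> and truncated to a polynomial, so that point masses have finite energy:
  finitely supported weights replace measures on \<open>E\<close>, and no weak limits are taken. The
  price is that a single \<open>r\<close> must serve all points of \<open>E\<close>, although
  potentials are only lower semicontinuous. The lower bound for the energy is one application of
  Cauchy-Schwarz: averaging a regularized potential that is at least 1/2 on \<open>E\<close> against
  weights of mass 1 pairs \<open>g\<close> with the average of translates of the kernel, and the
  squared norm of that average is the energy. The obstacle is analyticity. The squares of the Taylor
  coefficients of order one half decay like 1/m, so the energy kernel is logarithmic: its cosine
  part is unbounded as r tends to 1, but its sine part has decreasing coefficients of order 1/m and
  stays bounded. The same 1/m is the inverse of the Dirichlet weight, and for this reason an energy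
  controls the Dirichlet norm of the corresponding potential.\<close>

lemma bij_betw_axis_Basis: "bij_betw (\<lambda>i. axis i (1::real)) (UNIV :: 'n::finite set) Basis"
  by (auto simp: bij_betw_def inj_on_def Basis_vec_def axis_eq_axis)

text \<open>Fubini. The measure \<open>lborel\<close> is the image of a product measure indexed by
  basis vectors rather than by \<open>'n\<close>; \<open>ix\<close> translates basis vectors back
  into coordinates.\<close>

lemma lborel_integral_prod_components:
  fixes h :: "'n::finite \<Rightarrow> real \<Rightarrow> 'b::{real_normed_field,banach,second_countable_topology}"
  assumes "\<And>j. integrable lborel (h j)"
  shows "(LINT x|(lborel :: (real ^ 'n) measure). (\<Prod>j\<in>UNIV. h j (x $ j))) = (\<Prod>j\<in>UNIV. (LINT s|lborel. h j s))"
proof -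
  interpret product_sigma_finite "\<lambda>b::real^'n. lborel :: real measure" ..
  define ax where "ax = (\<lambda>i::'n. axis i (1::real))"
  define ix where "ix = the_inv_into UNIV ax"
  have bij: "bij_betw ax UNIV Basis" unfolding ax_def by (rule bij_betw_axis_Basis)
  have ix: "ix (ax j) = j" for j
    unfolding ix_def using bij by (auto simp: bij_betw_def the_inv_into_f_f)
  have re: "(\<Prod>j\<in>UNIV. F j) = (\<Prod>b\<in>Basis. F (ix b))" for F :: "'n \<Rightarrow> 'b"
    using prod.reindex_bij_betw[OF bij, of "\<lambda>b. F (ix b)"] by (simp add: ix)
  have [measurable]: "h j \<in> borel_measurable borel" for j
    using borel_measurable_integrable[OF assms[of j]] by simp
  have comp: "(\<Sum>c\<in>Basis. f c *\<^sub>R c) $ ix b = f b" if "b \<in> Basis" for f :: "real^'n \<Rightarrow> real" and b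
  proof -
    have b: "ax (ix b) = b" using bij that by (metis bij_betw_def f_the_inv_into_f ix_def)
    have "(\<Sum>c\<in>Basis. f c *\<^sub>R c) $ ix b = (\<Sum>c\<in>Basis. f c *\<^sub>R c) \<bullet> ax (ix b)"
      unfolding ax_def by (rule cart_eq_inner_axis)
    also have "\<dots> = (\<Sum>c\<in>Basis. f c *\<^sub>R c) \<bullet> b" by (simp only: b)
    also have "\<dots> = f b" using that by simp
    finally show ?thesis .
  qed
  have "(LINT x|(lborel :: (real ^ 'n) measure). (\<Prod>j\<in>UNIV. h j (x $ j)))
      = (LINT f|(\<Pi>\<^sub>M b\<in>Basis. lborel). (\<Prod>j\<in>UNIV. h j ((\<Sum>b\<in>Basis. f b *\<^sub>R b :: real^'n) $ j)))"
    by (subst lborel_eq, subst integral_distr) measurable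
  also have "\<dots> = (LINT f|(\<Pi>\<^sub>M b\<in>Basis. lborel). (\<Prod>b\<in>Basis. h (ix b) (f b)))"
    by (intro Bochner_Integration.integral_cong refl) (simp only: re comp cong: prod.cong)
  also have "\<dots> = (\<Prod>b\<in>Basis. (LINT s|lborel. h (ix b) s))"
    by (rule product_integral_prod) (auto intro: assms)
  also have "\<dots> = (\<Prod>j\<in>UNIV. (LINT s|lborel. h j s))"
    by (simp add: re)
  finally show ?thesis .
qed

section \<open>The normalized measure on the torus and means over one period\<close>

lemma space_torus_measure [simp]: "space torus_measure = torus"
  by (simp add: torus_measure_def)

lemma torus_borel [measurable]: "(torus :: (real^'n) set) \<in> sets borel"
  unfolding torus_def by measurable

lemma emeasure_lborel_torus: "emeasure lborel (torus :: (real^'n) set) = ennreal ((2 * pi) ^ CARD('n))"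
proof -
  have "emeasure lborel (torus :: (real^'n) set) = (\<integral>\<^sup>+x. indicator torus (x :: real^'n) \<partial>lborel)"
    by simp
  also have "\<dots> = (\<integral>\<^sup>+x. (\<Prod>b\<in>Basis. indicator {0..<2*pi} ((x::real^'n) \<bullet> b)) \<partial>lborel)"
  proof (intro nn_integral_cong)
    fix x :: "real^'n"
    have "x \<in> torus \<longleftrightarrow> (\<forall>b\<in>Basis. x \<bullet> b \<in> {0..<2*pi})"
      by (auto simp: torus_def Basis_vec_def inner_axis)
    note iff = this
    show "indicator torus x = (\<Prod>b\<in>Basis. indicator {0..<2*pi} (x \<bullet> b) :: ennreal)"
    proof (cases "x \<in> torus")
      case True
      then have "(\<Prod>b\<in>Basis. indicator {0..<2*pi} (x \<bullet> b) :: ennreal) = 1"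
        using iff by (intro prod.neutral) auto
      with True show ?thesis by simp
    next
      case False
      then obtain b where "b \<in> Basis" "x \<bullet> b \<notin> {0..<2*pi}" using iff by blast
      then have "(\<Prod>b\<in>Basis. indicator {0..<2*pi} (x \<bullet> b) :: ennreal) = 0"
        by (intro prod_zero) (auto intro!: bexI[of _ b])
      with False show ?thesis by simp
    qed
  qed
  also have "\<dots> = ennreal ((2 * pi) ^ CARD('n))"
  proof -
    have "(\<integral>\<^sup>+x. indicator {0..<2*pi} x \<partial>lborel) = ennreal (2 * pi)" by simp
    then show ?thesis by (subst nn_integral_lborel_prod) (simp_all add: ennreal_power del: power_mult_distrib)
  qed
  finally show ?thesis .
qed

lemma emeasure_torus: "emeasure (lebesgue_on torus) (torus :: (real^'n) set) = ennreal ((2 * pi) ^ CARD('n))"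
  proof -
  have "emeasure (lebesgue_on torus) (torus :: (real^'n) set) = emeasure lebesgue (torus :: (real^'n) set)"
    by (rule emeasure_restrict_space) (simp_all add: torus_borel sets_completionI_sets)
  also have "\<dots> = emeasure lborel (torus :: (real^'n) set)"
    using torus_borel by simp
  finally show ?thesis by (simp only: emeasure_lborel_torus)
qed

lemma emeasure_torus_measure_space: "emeasure (torus_measure :: (real^'n) measure) torus = 1"
  unfolding torus_measure_def
  by (rule emeasure_uniform_measure_1) (simp_all add: emeasure_torus)

lemma finite_measure_torus_measure: "finite_measure (torus_measure :: (real^'n) measure)"
  by (rule finite_measureI) (simp add: emeasure_torus_measure_space)

lemma borel_measurable_torus_measure:
  assumes "f \<in> borel_measurable borel"
  shows "f \<in> borel_measurable (torus_measure :: (real^'n) measure)"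
proof -
  have "f \<in> borel_measurable (lebesgue_on torus)"
    using assms by (simp add: measurable_completion measurable_restrict_space1)
  then show ?thesis
    unfolding torus_measure_def by (subst measurable_cong_sets[OF sets_uniform_measure refl])
qed

text \<open>For Borel integrands the completion can be left, which makes the product structure of
  \<open>lborel\<close> available.\<close>

lemma integral_torus_measure:
  fixes f :: "real ^ 'n \<Rightarrow> 'b::{banach, second_countable_topology}"
  assumes f [measurable]: "f \<in> borel_measurable borel"
  shows "integral\<^sup>L torus_measure f = (LINT x|lborel. indicator torus x *\<^sub>R f x) /\<^sub>R (2 * pi) ^ CARD('n)"
proof -
  have m: "f \<in> borel_measurable (lebesgue_on torus)"
    by (simp add: measurable_completion measurable_restrict_space1)
  have "integral\<^sup>L torus_measure f = integral\<^sup>L (density (lebesgue_on torus) (\<lambda>x. ennreal (1 / (2 * pi) ^ CARD('n)))) f"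
  proof -
    have "density (lebesgue_on torus) (\<lambda>x. indicator (torus :: (real^'n) set) x / emeasure (lebesgue_on torus) (torus :: (real^'n) set))
      = density (lebesgue_on torus) (\<lambda>x. ennreal (1 / (2 * pi) ^ CARD('n)))"
    proof (rule density_cong)
      have "1 / ennreal ((2 * pi) ^ CARD('n)) = ennreal (1 / (2 * pi) ^ CARD('n))"
        by (subst ennreal_1[symmetric], rule divide_ennreal) auto
      then show "AE x in lebesgue_on torus. indicator torus x / emeasure (lebesgue_on torus) (torus :: (real^'n) set)
          = ennreal (1 / (2 * pi) ^ CARD('n))"
        by (intro AE_I2) (simp add: emeasure_torus)
    qed (auto intro!: borel_measurable_divide_ennreal borel_measurable_indicator simp: emeasure_torus)
    then show ?thesis by (simp only: torus_measure_def uniform_measure_def)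
  qed
  also have "\<dots> = (LINT x|lebesgue_on torus. (1 / (2 * pi) ^ CARD('n)) *\<^sub>R f x)"
    by (rule integral_density) (auto intro: m)
  also have "\<dots> = (1 / (2 * pi) ^ CARD('n)) *\<^sub>R (LINT x|lebesgue. indicator torus x *\<^sub>R f x)"
    by (simp add: integral_restrict_space)
  also have "(LINT x|lebesgue. indicator torus x *\<^sub>R f x) = (LINT x|lborel. indicator torus x *\<^sub>R f x)"
    by (rule integral_completion) measurable
  finally show ?thesis by (simp add: divide_inverse)
qed

text \<open>The one-variable counterpart of integration against \<open>torus_measure\<close>. An
  indicator under \<open>lborel\<close> is used because the indicator of the torus factors into
  indicators of this form.\<close>

definition circle_mean :: "(real \<Rightarrow> 'b::{banach, second_countable_topology}) \<Rightarrow> 'b" where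
  "circle_mean h = (LINT s|lborel. indicator {0..<2*pi} s *\<^sub>R h s) /\<^sub>R (2 * pi)"

lemma integrable_lborel_circle:
  fixes h :: "real \<Rightarrow> 'b::{banach, second_countable_topology}"
  assumes "continuous_on UNIV h"
  shows "integrable lborel (\<lambda>s. indicator {0..<2*pi} s *\<^sub>R h s)"
proof -
  have "set_integrable lborel {0..2*pi} h"
    using borel_integrable_compact[of "{0..2*pi}" h] assms
    unfolding set_integrable_def using continuous_on_subset by blast
  then have "set_integrable lborel {0..<2*pi} h"
    by (rule set_integrable_subset) auto
  then show ?thesis by (simp add: set_integrable_def)
qed

lemma torus_integral_prod:
  fixes h :: "'n::finite \<Rightarrow> real \<Rightarrow> 'b::{real_normed_field,banach,second_countable_topology}"
  assumes c: "\<And>j. continuous_on UNIV (h j)"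
  shows "(LINT x|torus_measure. (\<Prod>j\<in>UNIV. h j (x $ j))) = (\<Prod>j\<in>UNIV. circle_mean (h j))"
proof -
  have [measurable]: "h j \<in> borel_measurable borel" for j
    using c by (simp add: borel_measurable_continuous_onI)
  have ind: "indicator torus x *\<^sub>R (\<Prod>j\<in>UNIV. h j (x $ j)) = (\<Prod>j\<in>UNIV. indicator {0..<2*pi} (x $ j) *\<^sub>R h j (x $ j))"
    for x :: "real^'n"
  proof (cases "x \<in> torus")
    case True
    then show ?thesis by (simp add: torus_def)
  next
    case False
    then obtain j where "x $ j \<notin> {0..<2*pi}" by (auto simp: torus_def)
    then have "(\<Prod>j\<in>UNIV. indicator {0..<2*pi} (x $ j) *\<^sub>R h j (x $ j)) = 0"
      by (intro prod_zero) (auto intro!: exI[of _ j])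
    with False show ?thesis by simp
  qed
  have "(LINT x|torus_measure. (\<Prod>j\<in>UNIV. h j (x $ j))) =
    (LINT x|lborel. indicator torus x *\<^sub>R (\<Prod>j\<in>UNIV. h j ((x::real^'n) $ j))) /\<^sub>R (2 * pi) ^ CARD('n)"
    by (rule integral_torus_measure) measurable
  also have "\<dots> = (\<Prod>j\<in>UNIV. (LINT s|lborel. indicator {0..<2*pi} s *\<^sub>R h j s)) /\<^sub>R (2 * pi) ^ CARD('n)"
    unfolding ind using lborel_integral_prod_components[of "\<lambda>j s. indicator {0..<2*pi} s *\<^sub>R h j s"]
      integrable_lborel_circle[OF c] by simp
  also have "\<dots> = (\<Prod>j\<in>UNIV. circle_mean (h j))"
    by (simp only: circle_mean_def scaleR_conv_of_real prod.distrib prod_constant power_inverse[symmetric] of_real_power)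
  finally show ?thesis .
qed

text \<open>All orthogonality relations below are obtained from this, by exhibiting a primitive with
  equal values at the two ends of the period.\<close>

lemma circle_mean_FTC:
  fixes F :: "real \<Rightarrow> 'b::euclidean_space"
  assumes "\<And>s. (F has_vector_derivative h s) (at s)" "continuous_on UNIV h" "F (2 * pi) = F 0"
  shows "circle_mean h = 0"
proof -
  have "(LINT s|lborel. indicator {0..<2*pi} s *\<^sub>R h s) = (LINT s|lborel. indicator {0..2*pi} s *\<^sub>R h s)"
  proof (rule integral_cong_AE)
    have [measurable]: "h \<in> borel_measurable borel" by (simp add: assms borel_measurable_continuous_onI)
    show "(\<lambda>s. indicator {0..<2*pi} s *\<^sub>R h s) \<in> borel_measurable lborel"
      "(\<lambda>s. indicator {0..2*pi} s *\<^sub>R h s) \<in> borel_measurable lborel" by measurable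
    show "AE s in lborel. indicator {0..<2*pi} s *\<^sub>R h s = indicator {0..2*pi} s *\<^sub>R h s"
      using AE_lborel_singleton[of "2*pi"] by eventually_elim (auto simp: indicator_def)
  qed
  also have "\<dots> = F (2*pi) - F 0"
    by (rule integral_FTC_atLeastAtMost)
       (auto intro: has_vector_derivative_at_within assms continuous_on_subset)
  finally show ?thesis by (simp add: circle_mean_def assms)
qed

lemma circle_mean_const [simp]: "circle_mean (\<lambda>s. c) = (c :: 'b::{banach, second_countable_topology})"
proof -
  have "(LINT s|lborel. indicator {0..<2*pi} s *\<^sub>R c) = (2*pi) *\<^sub>R c"
    by (subst integral_scaleR_left) auto
  then show ?thesis by (simp add: circle_mean_def)
qed

lemma circle_mean_cis:
  "circle_mean (\<lambda>s. cis (real_of_int k * s)) = (if k = 0 then 1 else 0)"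
proof (cases "k = 0")
  case False
  have "circle_mean (\<lambda>s. cis (real_of_int k * s)) = 0"
  proof (rule circle_mean_FTC[where F = "\<lambda>s. cis (real_of_int k * s) / (\<i> * of_int k)"])
    show "((\<lambda>s. cis (real_of_int k * s) / (\<i> * of_int k)) has_vector_derivative cis (real_of_int k * s)) (at s)" for s
      unfolding cis_conv_exp using False
      by (auto intro!: derivative_eq_intros has_vector_derivative_real_field simp: field_simps)
    show "continuous_on UNIV (\<lambda>s. cis (real_of_int k * s))" by (intro continuous_intros)
    have "cis (real_of_int k * (2 * pi)) = 1"
      by (metis cis_multiple_2pi Ints_of_int mult.commute)
    then show "cis (real_of_int k * (2 * pi)) / (\<i> * of_int k) = cis (real_of_int k * 0) / (\<i> * of_int k)"
      by simp
  qed
  with False show ?thesis by simp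
qed simp

text \<open>The phase \<open>x\<close> is carried along because the product of two translated
  cosines is a sum of cosines of this form.\<close>

lemma circle_mean_cos:
  "circle_mean (\<lambda>s. cos (x + real_of_int k * s)) = (if k = 0 then cos x else 0)"
proof (cases "k = 0")
  case False
  have "circle_mean (\<lambda>s. cos (x + real_of_int k * s)) = 0"
  proof (rule circle_mean_FTC[where F = "\<lambda>s. sin (x + real_of_int k * s) / of_int k"])
    show "((\<lambda>s. sin (x + real_of_int k * s) / of_int k) has_vector_derivative cos (x + real_of_int k * s)) (at s)" for s
      unfolding has_real_derivative_iff_has_vector_derivative[symmetric] using False
      by (auto intro!: derivative_eq_intros simp: field_simps)
    show "continuous_on UNIV (\<lambda>s. cos (x + real_of_int k * s))" by (intro continuous_intros)
    have "sin (x + real_of_int k * (2 * pi)) = sin x"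
      by (simp add: sin_add mult.commute[of "real_of_int k"] del: distrib_left_numeral)
    then show "sin (x + real_of_int k * (2 * pi)) / of_int k = sin (x + real_of_int k * 0) / of_int k"
      by simp
  qed
  with False show ?thesis by simp
qed simp

lemma torus_integral_cis:
  fixes k :: "'n::finite \<Rightarrow> int"
  shows "(LINT x|torus_measure. cis (\<Sum>j\<in>UNIV. real_of_int (k j) * x $ j)) = (if k = (\<lambda>_. 0) then 1 else 0)"
proof -
  have "(LINT x|torus_measure. cis (\<Sum>j\<in>UNIV. real_of_int (k j) * x $ j))
     = (LINT x|torus_measure. (\<Prod>j\<in>UNIV. cis (real_of_int (k j) * (x::real^'n) $ j)))"
    by (simp add: cis_conv_exp exp_sum sum_distrib_left)
  also have "\<dots> = (\<Prod>j\<in>UNIV. circle_mean (\<lambda>s. cis (real_of_int (k j) * s)))"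
    by (rule torus_integral_prod) (intro continuous_intros)
  also have "\<dots> = (\<Prod>j\<in>UNIV. if k j = 0 then 1 else 0)" by (simp add: circle_mean_cis)
  also have "\<dots> = (if k = (\<lambda>_. 0) then 1 else 0)" by (auto simp: fun_eq_iff)
  finally show ?thesis .
qed

subsection \<open>Sine series with decreasing coefficients\<close>

text \<open>Abel summation in inductive form: the sum is compared with its boundary term
  \<open>a n * S n\<close>, and the errors telescope to \<open>(a K - a n) * B\<close>.\<close>

lemma abs_sum_mult_antimono_le:
  fixes a s :: "nat \<Rightarrow> real"
  assumes a: "\<And>m. a (Suc m) \<le> a m" "\<And>m. 0 \<le> a m"
    and S: "\<And>n. \<bar>\<Sum>m=K..n. s m\<bar> \<le> B"
  shows "\<bar>\<Sum>m=K..n. a m * s m\<bar> \<le> a K * B"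
proof (cases "K \<le> n")
  case True
  define S where "S n = (\<Sum>m=K..n. s m)" for n
  have "\<bar>(\<Sum>m=K..n. a m * s m) - a n * S n\<bar> \<le> (a K - a n) * B"
    using True
  proof (induction rule: dec_induct)
    case base
    then show ?case by (simp add: S_def)
  next
    case (step n)
    have "(\<Sum>m=K..Suc n. a m * s m) - a (Suc n) * S (Suc n)
        = ((\<Sum>m=K..n. a m * s m) - a n * S n) + (a n - a (Suc n)) * S n"
      using step by (simp add: S_def algebra_simps)
    also have "\<bar>\<dots>\<bar> \<le> (a K - a n) * B + (a n - a (Suc n)) * B"
      using step a(1)[of n] S[of n]
      by (intro order.trans[OF abs_triangle_ineq] add_mono) (auto simp: abs_mult S_def intro!: mult_left_mono)
    finally show ?case by (simp add: algebra_simps)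
  qed
  moreover have "\<bar>a n * S n\<bar> \<le> a n * B"
    using a(2)[of n] S[of n] by (auto simp: abs_mult S_def intro!: mult_left_mono)
  ultimately show ?thesis by (simp add: algebra_simps)
next
  case False
  have "0 \<le> B" using S[of 0] by linarith
  with False a(2)[of K] show ?thesis by simp
qed

lemma abs_sin_nat_mult_le: "\<bar>sin (real m * x)\<bar> \<le> real m * \<bar>sin x\<bar>"
proof (induction m)
  case (Suc m)
  have "sin (real (Suc m) * x) = sin (real m * x) * cos x + cos (real m * x) * sin x"
    by (simp add: ring_distribs sin_add add.commute)
  also have "\<bar>\<dots>\<bar> \<le> \<bar>sin (real m * x)\<bar> * 1 + 1 * \<bar>sin x\<bar>"
    by (intro order.trans[OF abs_triangle_ineq] add_mono)
       (auto simp: abs_mult intro!: mult_left_mono mult_right_mono mult_left_le_one_le mult_right_le_one_le)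
  finally show ?case using Suc by (simp add: algebra_simps)
qed simp

text \<open>Multiplication by \<open>2 * sin (t / 2)\<close> makes the sum telescope. The lower
  limit is arbitrary because the bound is applied to tails.\<close>

lemma abs_sum_sin_le:
  assumes "sin (t / 2) \<noteq> 0"
  shows "\<bar>\<Sum>m=K..n. sin (real m * t)\<bar> \<le> 1 / \<bar>sin (t / 2)\<bar>"
proof (cases "K \<le> n")
  case True
  then have "2 * sin (t / 2) * (\<Sum>m=K..n. sin (real m * t)) = cos ((real K - 1/2) * t) - cos ((real n + 1/2) * t)"
  proof (induction rule: dec_induct)
    case base
    show ?case by (simp add: left_diff_distrib distrib_right cos_diff cos_add)
  next
    case (step n)
    have "2 * sin (t/2) * sin (real (Suc n) * t) = cos ((real n + 1/2) * t) - cos ((real (Suc n) + 1/2) * t)"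
    proof -
      have "(real n + 1/2) * t = real (Suc n) * t - t/2" "(real (Suc n) + 1/2) * t = real (Suc n) * t + t/2"
        by (simp_all add: algebra_simps)
      then show ?thesis by (simp add: cos_diff cos_add)
    qed
    with step show ?case by (simp add: distrib_left)
  qed
  from arg_cong[OF this, of abs] have "2 * (\<bar>sin (t / 2)\<bar> * \<bar>\<Sum>m=K..n. sin (real m * t)\<bar>) = \<bar>cos ((real K - 1/2) * t) - cos ((real n + 1/2) * t)\<bar>"
    by (simp only: abs_mult abs_numeral mult.assoc)
  also have "\<dots> \<le> 2"
    using abs_cos_le_one[of "(real K - 1/2) * t"] abs_cos_le_one[of "(real n + 1/2) * t"] by linarith
  finally show ?thesis using assms by (simp add: field_simps)
qed simp

text \<open>The sum is split at \<open>K\<close>, the integer part of 1/\<sigma>. Up to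
  \<open>K\<close> each term is at most 2\<sigma>, by \<open>a m \<le> 1/m\<close> and
  \<open>\<bar>sin (m t)\<bar> \<le> 2 m \<sigma>\<close>, for a total of at most 2; beyond
  \<open>K\<close> Abel summation gives at most \<open>a (Suc K) / \<sigma> \<le> 1\<close>.
  Measuring the distance of t from the period lattice by \<sigma> avoids reducing t modulo the
  period.\<close>

lemma abs_sine_series_le_3:
  fixes a :: "nat \<Rightarrow> real"
  assumes a: "\<And>m. a (Suc m) \<le> a m" "\<And>m. 0 \<le> a m" "\<And>m. a m * real m \<le> 1"
  shows "\<bar>\<Sum>m=1..M. a m * sin (real m * t)\<bar> \<le> 3"
proof (cases "sin (t / 2) = 0")
  case True
  have "sin (real m * t) = 0" for m
    using abs_sin_nat_mult_le[of "2 * m" "t / 2"] True by simp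
  then show ?thesis by simp
next
  case False
  define \<sigma> where "\<sigma> = \<bar>sin (t / 2)\<bar>"
  have \<sigma>: "\<sigma> > 0" using False by (simp add: \<sigma>_def)
  define K where "K = nat \<lfloor>1 / \<sigma>\<rfloor>"
  have K1: "real K * \<sigma> \<le> 1" and K2: "1 \<le> real (Suc K) * \<sigma>"
  proof -
    have "real K \<le> 1 / \<sigma>" "1 / \<sigma> \<le> real (Suc K)"
      unfolding K_def using \<sigma> by (simp_all, linarith+)
    then show "real K * \<sigma> \<le> 1" "1 \<le> real (Suc K) * \<sigma>" using \<sigma> by (simp_all add: field_simps)
  qed
  have s: "\<bar>sin (real m * t)\<bar> \<le> 2 * real m * \<sigma>" for m
    using abs_sin_nat_mult_le[of "2 * m" "t / 2"] by (simp add: \<sigma>_def)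
  have head: "\<bar>\<Sum>m=1..L. a m * sin (real m * t)\<bar> \<le> 2" if "L \<le> K" for L
  proof -
    have "\<bar>\<Sum>m=1..L. a m * sin (real m * t)\<bar> \<le> (\<Sum>m=1..L. 2 * \<sigma>)"
    proof (rule order.trans[OF sum_abs sum_mono])
      fix m
      have "\<bar>a m * sin (real m * t)\<bar> \<le> a m * (2 * real m * \<sigma>)"
        using a(2)[of m] s[of m] by (simp add: abs_mult mult_left_mono)
      also have "\<dots> = (a m * real m) * (2 * \<sigma>)" by simp
      also have "\<dots> \<le> 1 * (2 * \<sigma>)" using a(3)[of m] \<sigma> by (intro mult_right_mono) auto
      finally show "\<bar>a m * sin (real m * t)\<bar> \<le> 2 * \<sigma>" by simp
    qed
    also have "\<dots> \<le> 2 * (real K * \<sigma>)" using that \<sigma> by simp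
    finally show ?thesis using K1 by linarith
  qed
  show ?thesis
  proof (cases "M \<le> K")
    case True
    then show ?thesis using head[of M] by linarith
  next
    case False
    have "{1..M} = {1..K} \<union> {Suc K..M}" using False by auto
    then have "(\<Sum>m=1..M. a m * sin (real m * t)) = (\<Sum>m=1..K. a m * sin (real m * t)) + (\<Sum>m=Suc K..M. a m * sin (real m * t))"
      by (simp add: sum.union_disjoint)
    moreover have "\<bar>\<Sum>m=Suc K..M. a m * sin (real m * t)\<bar> \<le> a (Suc K) * (1 / \<sigma>)"
      unfolding \<sigma>_def by (intro abs_sum_mult_antimono_le a abs_sum_sin_le) (use \<open>sin (t/2) \<noteq> 0\<close> in auto)
    moreover have "a (Suc K) * (1 / \<sigma>) \<le> 1"
    proof -
      have "a (Suc K) * 1 \<le> a (Suc K) * (real (Suc K) * \<sigma>)"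
        using K2 a(2) by (intro mult_left_mono) auto
      also have "\<dots> = (a (Suc K) * real (Suc K)) * \<sigma>" by simp
      also have "\<dots> \<le> 1 * \<sigma>" using a(3)[of "Suc K"] \<sigma> by (intro mult_right_mono) auto
      finally show ?thesis using \<sigma> by (simp add: field_simps)
    qed
    ultimately show ?thesis using head[of K] by linarith
  qed
qed

subsection \<open>The kernel of order one half\<close>

text \<open>
  \<open>beta m = (2m choose m) / 4^m\<close>, the Taylor coefficients of \<open>(1 - z) powr (-1/2)\<close>.
\<close>

primrec beta :: "nat \<Rightarrow> real" where
  "beta 0 = 1"
| "beta (Suc m) = beta m * ((2 * real m + 1) / (2 * real m + 2))"

lemma beta_pos: "0 < beta m"
  by (induction m) (auto intro!: mult_pos_pos divide_pos_pos)

lemma beta_antimono: "beta (Suc m) \<le> beta m"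
proof -
  have "beta m * ((2 * real m + 1) / (2 * real m + 2)) \<le> beta m * 1"
    using beta_pos[of m] by (intro mult_left_mono) auto
  then show ?thesis by simp
qed

lemma beta_le_1: "beta m \<le> 1"
  by (induction m) (use beta_antimono order.trans in \<open>auto simp del: beta.simps(2)\<close>)

text \<open>Induction on the ratio of consecutive coefficients. The resulting decay
  \<open>(beta m)\<^sup>2 \<le> 1 / (m + 1)\<close> is the link between a kernel of order one half
  and the Dirichlet weight.\<close>

lemma beta_square_le: "(beta m)\<^sup>2 * (real m + 1) \<le> 1"
proof (induction m)
  case (Suc m)
  have "((2 * real m + 1) / (2 * real m + 2))\<^sup>2 * (real m + 2) \<le> real m + 1"
  proof -
    have "(2 * real m + 1)\<^sup>2 * (real m + 2) \<le> (real m + 1) * (2 * real m + 2)\<^sup>2"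
      by (simp add: power2_eq_square algebra_simps)
    then show ?thesis by (simp add: power_divide pos_divide_le_eq)
  qed
  then have "(beta m)\<^sup>2 * (((2 * real m + 1) / (2 * real m + 2))\<^sup>2 * (real m + 2)) \<le> (beta m)\<^sup>2 * (real m + 1)"
    by (intro mult_left_mono) auto
  also have "(beta m)\<^sup>2 * (((2 * real m + 1) / (2 * real m + 2))\<^sup>2 * (real m + 2)) = (beta (Suc m))\<^sup>2 * (real (Suc m) + 1)"
    by (simp only: beta.simps power_mult_distrib mult.assoc of_nat_Suc) simp
  finally show ?case using Suc by linarith
qed simp

lemma gbinomial_minus_half: "((-1/2 :: complex) gchoose m) = (-1) ^ m * of_real (beta m)"
proof (induction m)
  case (Suc m)
  have "of_nat (Suc m) * ((-1/2 :: complex) gchoose Suc m) = (-1/2 - of_nat m) * ((-1/2) gchoose m)"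
    using gbinomial_mult_1[of "-1/2 :: complex" m] by (simp add: algebra_simps)
  then have "((-1/2 :: complex) gchoose Suc m) = (-1/2 - of_nat m) * ((-1/2) gchoose m) / of_nat (Suc m)"
    by (simp add: field_simps del: of_nat_Suc)
  also have "\<dots> = (-1/2 - of_nat m) * ((-1) ^ m * of_real (beta m)) / of_nat (Suc m)"
    by (simp only: Suc)
  also have "\<dots> = (-1) ^ Suc m * of_real (beta (Suc m))"
  proof -
    have "1 + of_nat m \<noteq> (0::complex)" "2 + 2 * of_nat m \<noteq> (0::complex)"
      using of_nat_eq_0_iff[of "Suc m", where 'a=complex] of_nat_eq_0_iff[of "2 * Suc m", where 'a=complex]
      by (simp_all del: of_nat_eq_0_iff)
    then show ?thesis by (simp add: field_simps)
  qed
  finally show ?case .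
qed simp

lemma beta_sums:
  assumes "norm (z::complex) < 1"
  shows "(\<lambda>m. of_real (beta m) * z ^ m) sums ((1 - z) powr (-1/2))"
proof -
  have "(\<lambda>m. ((-1/2 :: complex) gchoose m) * (- z) ^ m) sums ((1 + - z) powr (-1/2))"
    by (rule gen_binomial_complex) (use assms in simp)
  moreover have "((-1/2 :: complex) gchoose m) * (- z) ^ m = of_real (beta m) * z ^ m" for m
  proof -
    have "(-1) ^ m * (- z) ^ m = z ^ m" by (simp flip: power_mult_distrib)
    then show ?thesis by (simp only: gbinomial_minus_half mult.commute[of "(-1)^m"] mult.assoc)
  qed
  ultimately show ?thesis by simp
qed

text \<open>The root halves the argument, which is thus at most pi/4 in absolute value; the cruder
  angle pi/3 is used since its cosine is 1/2.\<close>

lemma Re_powr_minus_half_ge: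
  assumes "0 < Re w"
  shows "Re (w powr (-1/2)) \<ge> (1/2) / sqrt (cmod w)"
proof -
  have w: "w \<noteq> 0" using assms by auto
  have im: "\<bar>Im (Ln w)\<bar> < pi / 2" by (rule Re_Ln_pos_lt_imp[OF assms])
  have "Re (w powr (-1/2)) = exp (- ln (cmod w) / 2) * cos (Im (Ln w) / 2)"
    using w by (simp add: powr_def Re_exp)
  moreover have "cos (Im (Ln w) / 2) \<ge> cos (pi / 3)"
  proof -
    have "cos \<bar>Im (Ln w) / 2\<bar> \<ge> cos (pi / 3)"
      using im by (intro cos_monotone_0_pi_le) auto
    moreover have "cos x = cos \<bar>x\<bar>" for x :: real by (simp add: abs_if)
    ultimately show ?thesis by metis
  qed
  moreover have "exp (- ln (cmod w) / 2) = 1 / sqrt (cmod w)"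
    using w by (simp add: exp_minus powr_half_sqrt[symmetric] powr_def inverse_eq_divide)
  moreover have "(1/2) / sqrt (cmod w) \<le> (1 / sqrt (cmod w)) * cos (Im (Ln w) / 2)" if "1/2 \<le> cos (Im (Ln w) / 2)"
    using mult_left_mono[OF that, of "1 / sqrt (cmod w)"] by simp
  ultimately show ?thesis by (simp add: cos_60)
qed

text \<open>The tail beyond \<open>M\<close> is dominated by a geometric series, uniformly in t, and
  made at most 1/8. It is absorbed by half of the lower bound
  \<open>(1/2) / sqrt (cmod (1 - z))\<close> for the full series: that half is at least 1/8, because
  \<open>cmod (1 - z) \<le> 4\<close>.\<close>

lemma cos_sum_beta_ge:
  assumes r: "0 \<le> r" "r < 1"
  shows "\<exists>M. \<forall>t. (\<Sum>m\<le>M. beta m * r ^ m * cos (real m * t)) \<ge> (1/4) / sqrt (cmod (1 - of_real r * cis t))"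
proof -
  have "(\<lambda>N. r ^ N / (1 - r)) \<longlonglongrightarrow> 0 / (1 - r)"
    using r by (intro tendsto_intros LIMSEQ_realpow_zero) auto
  then have "eventually (\<lambda>N. r ^ N / (1 - r) < 1/8) sequentially"
    by (rule order_tendstoD) auto
  then obtain M0 where M0: "r ^ M0 / (1 - r) < 1/8"
    by (auto simp: eventually_sequentially)
  define M where "M = M0"
  have "r ^ Suc M / (1 - r) < 1/8"
    by (rule le_less_trans[OF divide_right_mono M0]) (use r in \<open>auto simp: M_def mult_left_le_one_le\<close>)
  note M = this
  have "(1/4) / sqrt (cmod (1 - of_real r * cis t)) \<le> (\<Sum>m\<le>M. beta m * r ^ m * cos (real m * t))" for t
  proof -
    define z where "z = of_real r * cis t"
    define f where "f m = of_real (beta m) * z ^ m" for m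
    have nz: "norm z = r" using r by (simp add: z_def norm_mult)
    have fs: "f sums ((1 - z) powr (-1/2))" unfolding f_def by (rule beta_sums) (use nz r in simp)
    have f_le: "norm (f m) \<le> r ^ m" for m
      using beta_le_1[of m] beta_pos[of m] r by (simp add: f_def norm_mult norm_power nz mult_left_le_one_le)
    have gs: "(\<lambda>m. r ^ (m + Suc M)) sums (r ^ Suc M / (1 - r))"
    proof -
      have eq: "r ^ (m + Suc M) = r ^ Suc M * r ^ m" for m by (simp add: power_add)
      have "(\<lambda>m. r ^ Suc M * r ^ m) sums (r ^ Suc M * (1 / (1 - r)))"
        by (intro sums_mult geometric_sums) (use r in simp)
      then show ?thesis unfolding eq by (simp only: times_divide_eq_right mult_1_right)
    qed
    have "(1 - z) powr (-1/2) - (\<Sum>m<Suc M. f m) = (\<Sum>m. f (m + Suc M))"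
      using suminf_minus_initial_segment[OF sums_summable[OF fs], of "Suc M"] sums_unique[OF fs] by simp
    also have "norm \<dots> \<le> r ^ Suc M / (1 - r)"
      using norm_suminf_le[of "\<lambda>m. f (m + Suc M)" "\<lambda>m. r ^ (m + Suc M)"] f_le sums_summable[OF gs] sums_unique[OF gs]
      by metis
    finally have "cmod ((1 - z) powr (-1/2) - (\<Sum>m<Suc M. f m)) \<le> 1/8"
      using M by linarith
    then have "Re ((1 - z) powr (-1/2)) - Re (\<Sum>m<Suc M. f m) \<le> 1/8"
      using complex_Re_le_cmod[of "(1 - z) powr (-1/2) - (\<Sum>m<Suc M. f m)"]
      unfolding minus_complex.sel by linarith
    moreover have "Re (\<Sum>m<Suc M. f m) = (\<Sum>m\<le>M. beta m * r ^ m * cos (real m * t))"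
      unfolding lessThan_Suc_atMost
      by (simp add: f_def z_def power_mult_distrib Complex.DeMoivre mult.assoc Re_sum of_real_power[symmetric] del: of_real_power)
    moreover have "Re ((1 - z) powr (-1/2)) \<ge> (1/2) / sqrt (cmod (1 - z))"
      using complex_Re_le_cmod[of z] nz r by (intro Re_powr_minus_half_ge) simp
    moreover have "1/8 \<le> (1/4) / sqrt (cmod (1 - z))"
    proof -
      have "cmod (1 - z) \<le> 2\<^sup>2" using norm_triangle_ineq4[of 1 z] nz r by simp
      then have "sqrt (cmod (1 - z)) \<le> 2" by (intro real_le_lsqrt) auto
      moreover have "cmod (1 - z) > 0" using nz r by auto
      ultimately show ?thesis by (simp add: field_simps)
    qed
    ultimately show ?thesis unfolding z_def by (simp add: field_simps)
  qed
  then show ?thesis by blast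
qed

subsection \<open>Regularized potentials\<close>

text \<open>Adding \<delta> inside the root makes the kernel finite on the diagonal. This particular
  regularization compares directly with the modulus of 1 - r e^(it) when \<delta> = 1 - r.\<close>

definition reg_kernel :: "real \<Rightarrow> real ^ 'n \<Rightarrow> real ^ 'n \<Rightarrow> real" where
  "reg_kernel \<delta> \<theta> \<psi> = (\<Prod>j\<in>UNIV. 1 / sqrt (cmod (cis (\<theta> $ j) - cis (\<psi> $ j)) + \<delta>))"

lemma borel_measurable_reg_kernel [measurable]: "reg_kernel \<delta> \<theta> \<in> borel_measurable (borel :: (real^'n) measure)"
proof -
  have [measurable]: "cis \<in> borel_measurable borel"
    by (intro borel_measurable_continuous_onI continuous_intros)
  show ?thesis unfolding reg_kernel_def by measurable
qed

lemma ennreal_reg_kernel: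
  assumes "0 < \<delta>"
  shows "ennreal (reg_kernel \<delta> \<theta> \<psi>) = (\<Prod>j\<in>UNIV. inverse (ennreal (sqrt (cmod (cis (\<theta> $ j) - cis (\<psi> $ j)) + \<delta>))))"
proof -
  have "ennreal (reg_kernel \<delta> \<theta> \<psi>) = (\<Prod>j\<in>UNIV. ennreal (1 / sqrt (cmod (cis (\<theta> $ j) - cis (\<psi> $ j)) + \<delta>)))"
    unfolding reg_kernel_def using assms by (subst prod_ennreal) auto
  also have "\<dots> = (\<Prod>j\<in>UNIV. inverse (ennreal (sqrt (cmod (cis (\<theta> $ j) - cis (\<psi> $ j)) + \<delta>))))"
    by (intro prod.cong refl, subst inverse_ennreal) (use assms in \<open>auto simp: divide_inverse add_nonneg_pos\<close>)
  finally show ?thesis .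
qed

text \<open>Multiplication in \<open>ennreal\<close> is discontinuous only at 0 times infinity. The
  limit of the partial product must therefore be known to be nonzero at every step, and the second
  conjunct carries this through the induction.\<close>

lemma tendsto_prod_ennreal_pos:
  fixes f :: "'i \<Rightarrow> nat \<Rightarrow> ennreal"
  assumes "finite I" "\<And>i. i \<in> I \<Longrightarrow> f i \<longlonglongrightarrow> l i" "\<And>i. i \<in> I \<Longrightarrow> l i \<noteq> 0"
  shows "(\<lambda>k. \<Prod>i\<in>I. f i k) \<longlonglongrightarrow> (\<Prod>i\<in>I. l i) \<and> (\<Prod>i\<in>I. l i) \<noteq> 0"
  using assms
proof (induction I rule: finite_induct)
  case (insert i I)
  then have "f i \<longlonglongrightarrow> l i" "l i \<noteq> 0" "(\<lambda>k. \<Prod>i\<in>I. f i k) \<longlonglongrightarrow> (\<Prod>i\<in>I. l i)" "(\<Prod>i\<in>I. l i) \<noteq> 0"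
    by auto
  moreover from this have "(\<lambda>k. f i k * (\<Prod>i\<in>I. f i k)) \<longlonglongrightarrow> l i * (\<Prod>i\<in>I. l i)"
    by (intro tendsto_mult_ennreal) auto
  ultimately show ?case using insert by (simp add: insert)
qed simp

text \<open>
  Fatou's lemma takes the place of Dini's theorem: no continuity of potentials is needed. The
  kernel limit is never \<open>0\<close>, hence the product with \<open>g \<psi>\<close> can only fail to converge where
  \<open>g \<psi>\<close> vanishes, and there the inequality is trivial.
\<close>

lemma potential_le_liminf:
  fixes \<theta>s :: "nat \<Rightarrow> real ^ 'n"
  assumes g: "g \<in> borel_measurable torus_measure"
    and lim: "(\<lambda>k. torus_map (\<theta>s k)) \<longlonglongrightarrow> torus_map \<theta>"
    and \<delta>: "\<delta> \<longlonglongrightarrow> 0" "\<And>k. 0 < \<delta> k"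
  shows "potential g \<theta> \<le> liminf (\<lambda>k. \<integral>\<^sup>+ \<psi>. ennreal (reg_kernel (\<delta> k) (\<theta>s k) \<psi>) * ennreal (g \<psi>) \<partial>torus_measure)"
proof -
  have cis_lim: "(\<lambda>k. cis (\<theta>s k $ j)) \<longlonglongrightarrow> cis (\<theta> $ j)" for j
    using tendsto_vec_nth[OF lim, of j] by (simp add: torus_map_def)
  define k0 where "k0 \<psi> = (\<Prod>j\<in>UNIV. 1 / ennreal (sqrt (cmod (cis (\<theta> $ j) - cis (\<psi> $ j)))))" for \<psi> :: "real^'n"
  have ker: "(\<lambda>k. ennreal (reg_kernel (\<delta> k) (\<theta>s k) \<psi>)) \<longlonglongrightarrow> k0 \<psi> \<and> k0 \<psi> \<noteq> 0" for \<psi>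
  proof -
    have "(\<lambda>k. inverse (ennreal (sqrt (cmod (cis (\<theta>s k $ j) - cis (\<psi> $ j)) + \<delta> k))))
        \<longlonglongrightarrow> inverse (ennreal (sqrt (cmod (cis (\<theta> $ j) - cis (\<psi> $ j)))))" for j
    proof -
      have "(\<lambda>k. sqrt (cmod (cis (\<theta>s k $ j) - cis (\<psi> $ j)) + \<delta> k)) \<longlonglongrightarrow> sqrt (cmod (cis (\<theta> $ j) - cis (\<psi> $ j)) + 0)"
        by (intro tendsto_intros cis_lim \<delta>)
      then have "(\<lambda>k. ennreal (sqrt (cmod (cis (\<theta>s k $ j) - cis (\<psi> $ j)) + \<delta> k))) \<longlonglongrightarrow> ennreal (sqrt (cmod (cis (\<theta> $ j) - cis (\<psi> $ j))))"
        by (intro tendsto_ennrealI) simp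
      moreover have "continuous_on UNIV (inverse :: ennreal \<Rightarrow> ennreal)"
        by (intro continuous_on_inverse_ennreal continuous_on_id)
      ultimately show ?thesis
        using continuous_on_tendsto_compose[of UNIV inverse] by auto
    qed
    then have "(\<lambda>k. \<Prod>j\<in>UNIV. inverse (ennreal (sqrt (cmod (cis (\<theta>s k $ j) - cis (\<psi> $ j)) + \<delta> k))))
        \<longlonglongrightarrow> (\<Prod>j\<in>UNIV. inverse (ennreal (sqrt (cmod (cis (\<theta> $ j) - cis (\<psi> $ j))))))
      \<and> (\<Prod>j\<in>UNIV. inverse (ennreal (sqrt (cmod (cis (\<theta> $ j) - cis (\<psi> $ j)))))) \<noteq> 0"
      by (intro tendsto_prod_ennreal_pos) auto
    then show ?thesis by (simp add: ennreal_reg_kernel \<delta> k0_def divide_ennreal_def)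
  qed
  have m: "(\<lambda>\<psi>. ennreal (reg_kernel (\<delta> k) (\<theta>s k) \<psi>) * ennreal (g \<psi>)) \<in> borel_measurable torus_measure" for k
    using g borel_measurable_torus_measure[OF borel_measurable_reg_kernel] by measurable
  have "potential g \<theta> = (\<integral>\<^sup>+ \<psi>. k0 \<psi> * ennreal (g \<psi>) \<partial>torus_measure)"
    by (simp add: potential_def k0_def)
  also have "\<dots> \<le> (\<integral>\<^sup>+ \<psi>. liminf (\<lambda>k. ennreal (reg_kernel (\<delta> k) (\<theta>s k) \<psi>) * ennreal (g \<psi>)) \<partial>torus_measure)"
  proof (rule nn_integral_mono)
    fix \<psi>
    show "k0 \<psi> * ennreal (g \<psi>) \<le> liminf (\<lambda>k. ennreal (reg_kernel (\<delta> k) (\<theta>s k) \<psi>) * ennreal (g \<psi>))"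
    proof (cases "ennreal (g \<psi>) = 0")
      case False
      then have "(\<lambda>k. ennreal (reg_kernel (\<delta> k) (\<theta>s k) \<psi>) * ennreal (g \<psi>)) \<longlonglongrightarrow> k0 \<psi> * ennreal (g \<psi>)"
        using ker[of \<psi>] by (intro tendsto_mult_ennreal tendsto_const) auto
      then show ?thesis by (simp add: lim_imp_Liminf)
    qed simp
  qed
  also have "\<dots> \<le> liminf (\<lambda>k. \<integral>\<^sup>+ \<psi>. ennreal (reg_kernel (\<delta> k) (\<theta>s k) \<psi>) * ennreal (g \<psi>) \<partial>torus_measure)"
    by (rule nn_integral_liminf[OF m])
  finally show ?thesis .
qed

text \<open>If every \<delta> failed, points of failure for a sequence \<delta> tending to 0 would
  accumulate, by compactness in the topology of \<open>torus_map\<close>, at some \<theta> in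
  \<open>E\<close>, and lower semicontinuity would give
  \<open>potential g \<theta> \<le> 1/2\<close>. This is where compactness of \<open>E\<close>
  enters the whole argument; the gap between 1/2 and 1 yields the contradiction.\<close>

lemma reg_potential_uniform:
  fixes E :: "(real ^ 'n) set"
  assumes E: "torus_compact E"
    and g: "g \<in> borel_measurable torus_measure"
    and pot: "\<And>\<theta>. \<theta> \<in> E \<Longrightarrow> 1 \<le> potential g \<theta>"
  shows "\<exists>\<delta>>0. \<delta> < 1 \<and> (\<forall>\<theta>\<in>E. ennreal (1/2) \<le> (\<integral>\<^sup>+ \<psi>. ennreal (reg_kernel \<delta> \<theta> \<psi>) * ennreal (g \<psi>) \<partial>torus_measure))"
proof (rule ccontr)
  \<comment> \<open>The offset 2 keeps all values strictly below 1, so that 1 - \<delta> can later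
    be a positive radius.\<close>
  define \<delta> where "\<delta> k = 1 / (real k + 2)" for k
  have \<delta>: "0 < \<delta> k" "\<delta> k < 1" for k by (simp_all add: \<delta>_def)
  assume "\<not> ?thesis"
  then have "\<forall>k. \<exists>\<theta>\<in>E. (\<integral>\<^sup>+ \<psi>. ennreal (reg_kernel (\<delta> k) \<theta> \<psi>) * ennreal (g \<psi>) \<partial>torus_measure) < ennreal (1/2)"
    using \<delta> by (meson not_le)
  then obtain \<theta>s where \<theta>s: "\<And>k. \<theta>s k \<in> E"
    "\<And>k. (\<integral>\<^sup>+ \<psi>. ennreal (reg_kernel (\<delta> k) (\<theta>s k) \<psi>) * ennreal (g \<psi>) \<partial>torus_measure) < ennreal (1/2)"
    by metis
  have "seq_compact (torus_map ` E)"
    using E by (simp add: torus_compact_def compact_eq_seq_compact_metric)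
  moreover have "\<forall>k. torus_map (\<theta>s k) \<in> torus_map ` E" using \<theta>s by auto
  ultimately obtain z s where z: "z \<in> torus_map ` E" and s: "strict_mono (s :: nat \<Rightarrow> nat)"
    and lim: "((\<lambda>k. torus_map (\<theta>s k)) \<circ> s) \<longlonglongrightarrow> z"
    using seq_compactE by metis
  obtain \<theta> where \<theta>: "\<theta> \<in> E" "z = torus_map \<theta>" using z by auto
  have "\<delta> \<longlonglongrightarrow> 0"
    unfolding \<delta>_def using LIMSEQ_ignore_initial_segment[OF lim_1_over_n[where 'a=real], of 2]
    by (simp add: add.commute)
  then have "(\<lambda>k. \<delta> (s k)) \<longlonglongrightarrow> 0"
    using LIMSEQ_subseq_LIMSEQ[OF _ s] by (auto simp: o_def)
  then have "potential g \<theta> \<le> liminf (\<lambda>k. \<integral>\<^sup>+ \<psi>. ennreal (reg_kernel (\<delta> (s k)) (\<theta>s (s k)) \<psi>) * ennreal (g \<psi>) \<partial>torus_measure)"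
    using lim \<theta> \<delta> by (intro potential_le_liminf g) (auto simp: o_def)
  also have "\<dots> \<le> ennreal (1/2)"
  proof -
    have "liminf (\<lambda>k. \<integral>\<^sup>+ \<psi>. ennreal (reg_kernel (\<delta> (s k)) (\<theta>s (s k)) \<psi>) * ennreal (g \<psi>) \<partial>torus_measure)
      \<le> liminf (\<lambda>k. ennreal (1/2))"
      using \<theta>s(2) by (intro Liminf_mono always_eventually allI less_imp_le) auto
    then show ?thesis by (simp add: Liminf_const)
  qed
  finally have "1 \<le> ennreal (1/2)" using pot[OF \<theta>(1)] order.trans by blast
  moreover have "ennreal (1/2) < 1" by (simp only: ennreal_less_one_iff)
  ultimately show False by simp
qed

subsection \<open>Near minimizers of the energy\<close>

text \<open>
  First-order condition at an approximate minimizer of the energy over the finitely supported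
  probability weights on \<open>E\<close>; near minimality replaces a compactness argument.
\<close>

lemma kernel_near_minimizer:
  fixes G :: "'a \<Rightarrow> 'a \<Rightarrow> real" and E :: "'a set"
  defines "Q \<equiv> \<lambda>F c. \<Sum>i\<in>F. \<Sum>j\<in>F. c i * c j * G i j"
  defines "W \<equiv> {(F, c). finite F \<and> F \<subseteq> E \<and> (\<forall>i\<in>F. 0 \<le> c i) \<and> sum c F = (1::real)}"
  assumes sym: "\<And>i j. G i j = G j i"
    and ne: "E \<noteq> {}"
    and R: "\<And>i. i \<in> E \<Longrightarrow> G i i \<le> R"
    and I: "0 < I" "\<And>F c. (F, c) \<in> W \<Longrightarrow> I \<le> Q F c"
  shows "\<exists>F c. (F, c) \<in> W \<and> (\<forall>j\<in>E. Q F c \<le> 2 * (\<Sum>i\<in>F. c i * G i j))"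
proof -
  define X where "X = (\<lambda>(F, c). Q F c) ` W"
  obtain e0 where e0: "e0 \<in> E" using ne by blast
  have "({e0}, \<lambda>_. 1) \<in> W" using e0 by (simp add: W_def)
  then have Xne: "X \<noteq> {}" and IR: "I \<le> R"
    using I(2)[of "{e0}" "\<lambda>_. 1"] R[OF e0] by (auto simp: X_def Q_def)
  have bdd: "bdd_below X" using I(2) by (intro bdd_belowI[of _ I]) (auto simp: X_def)
  \<comment> \<open>Moving a fraction t of the mass to a point j costs a second-order term of at
    most \<open>t\<^sup>2 * R\<close>, and near minimality costs \<eta>. With this t both equal
    \<open>t * I / 2\<close>, so together they are at most \<open>t * Q F c\<close>. This loss is
    the origin of the factor 2 in the conclusion. Point masses show \<open>I \<le> R\<close>, hence
    \<open>t \<le> 1/2\<close>.\<close>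
  define t where "t = I / (2 * R)"
  have t: "0 < t" "t \<le> 1/2" using I(1) IR by (auto simp: t_def field_simps)
  define \<eta> where "\<eta> = t * I / 2"
  have "\<eta> > 0" using t I(1) by (simp add: \<eta>_def)
  then have "\<exists>x\<in>X. x < Inf X + \<eta>" using cInf_lessD[OF Xne, of "Inf X + \<eta>"] by auto
  then obtain F c where W: "(F, c) \<in> W" and Qc: "Q F c < Inf X + \<eta>" by (auto simp: X_def)
  have fin: "finite F" and FE: "F \<subseteq> E" and c0: "\<And>i. i \<in> F \<Longrightarrow> 0 \<le> c i" and c1: "sum c F = 1"
    using W by (auto simp: W_def)
  have "Q F c \<le> 2 * (\<Sum>i\<in>F. c i * G i j)" if j: "j \<in> E" for j
  proof -
    \<comment> \<open>Nothing is known about \<open>c\<close> outside \<open>F\<close>, and j may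
      lie inside or outside \<open>F\<close>; cutting \<open>c\<close> off by 0 treats both cases at
      once.\<close>
    define e where "e i = (if i \<in> F then c i else 0)" for i
    define d where "d i = (if i = j then 1 else (0::real))" for i
    define c' where "c' i = (1 - t) * e i + t * d i" for i
    define F' where "F' = insert j F"
    have fin': "finite F'" using fin by (simp add: F'_def)
    have sum_e: "(\<Sum>i\<in>F'. e i * f i) = (\<Sum>i\<in>F. c i * f i)" for f
    proof -
      have "(\<Sum>i\<in>F'. e i * f i) = (\<Sum>i\<in>F. e i * f i)"
        by (rule sum.mono_neutral_right) (auto simp: F'_def e_def fin)
      then show ?thesis by (simp add: e_def)
    qed
    have sum_d: "(\<Sum>i\<in>F'. d i * f i) = f j" for f
    proof -
      have "(\<Sum>i\<in>F'. d i * f i) = (\<Sum>i\<in>F'. if i = j then f j else 0)"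
        by (rule sum.cong) (auto simp: d_def)
      then show ?thesis using fin' by (simp add: F'_def)
    qed
    have sum_c': "(\<Sum>i\<in>F'. c' i * f i) = (1 - t) * (\<Sum>i\<in>F. c i * f i) + t * f j" for f
    proof -
      have "(\<Sum>i\<in>F'. c' i * f i) = (1 - t) * (\<Sum>i\<in>F'. e i * f i) + t * (\<Sum>i\<in>F'. d i * f i)"
        by (simp add: c'_def distrib_right sum.distrib sum_distrib_left mult.assoc)
      then show ?thesis by (simp add: sum_e sum_d)
    qed
    have "(F', c') \<in> W"
      using sum_c'[of "\<lambda>_. 1"] c1 j FE fin' t c0 by (auto simp: W_def F'_def c'_def e_def d_def)
    then have "Inf X \<le> Q F' c'" using bdd by (auto simp: X_def intro!: cInf_lower)
    with Qc have *: "Q F c - \<eta> \<le> Q F' c'" by simp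
    define V where "V = (\<Sum>i\<in>F. c i * G i j)"
    have "Q F' c' = (\<Sum>i\<in>F'. c' i * (\<Sum>l\<in>F'. c' l * G i l))"
      by (simp add: Q_def sum_distrib_left mult.assoc)
    also have "\<dots> = (1 - t)\<^sup>2 * Q F c + 2 * t * (1 - t) * V + t\<^sup>2 * G j j"
    proof -
      have eq1: "(\<Sum>i\<in>F. c i * ((1 - t) * (\<Sum>l\<in>F. c l * G i l) + t * G i j)) = (1 - t) * Q F c + t * V"
        by (simp add: Q_def V_def distrib_left sum.distrib sum_distrib_left algebra_simps)
      moreover have eq2: "(\<Sum>l\<in>F. c l * G j l) = V" by (simp add: V_def sym[of j])
      ultimately show ?thesis
        unfolding sum_c' eq1 eq2 by (simp add: algebra_simps power2_eq_square)
    qed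
    also have "\<dots> \<le> (1 - t)\<^sup>2 * Q F c + 2 * t * (1 - t) * V + t\<^sup>2 * R"
      using R[OF j] by (intro add_left_mono mult_left_mono) auto
    finally have "Q F c - \<eta> \<le> (1 - t)\<^sup>2 * Q F c + 2 * t * (1 - t) * V + t\<^sup>2 * R"
      using * by linarith
    moreover have "t\<^sup>2 * R = \<eta>" using I IR by (simp add: t_def \<eta>_def power2_eq_square field_simps)
    moreover have "2 * \<eta> \<le> t * Q F c" using I(2)[OF W] t by (simp add: \<eta>_def)
    ultimately have "0 \<le> t * (1 - t) * (2 * V - Q F c)"
      by (simp add: algebra_simps power2_eq_square)
    moreover have "0 < t * (1 - t)" using t by simp
    ultimately show ?thesis by (simp add: zero_le_mult_iff V_def)
  qed
  with W show ?thesis by blast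
qed

subsection \<open>The analytic energy kernel\<close>

lemma circle_mean_add:
  assumes "continuous_on UNIV f" "continuous_on UNIV g"
  shows "circle_mean (\<lambda>s. f s + g s) = circle_mean f + circle_mean g"
  using integrable_lborel_circle[OF assms(1)] integrable_lborel_circle[OF assms(2)]
  by (simp add: circle_mean_def scaleR_add_right)

lemma circle_mean_cmult:
  fixes f :: "real \<Rightarrow> real"
  assumes "continuous_on UNIV f"
  shows "circle_mean (\<lambda>s. c * f s) = c * circle_mean f"
  using integral_mult_right_zero[of lborel c "\<lambda>s. indicator {0..<2*pi} s *\<^sub>R f s"]
  by (simp add: circle_mean_def mult.left_commute)

lemma circle_mean_sum:
  assumes "\<And>i. i \<in> I \<Longrightarrow> continuous_on UNIV (f i)"
  shows "circle_mean (\<lambda>s. \<Sum>i\<in>I. f i s) = (\<Sum>i\<in>I. circle_mean (f i))"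
  using assms
proof (induction I rule: infinite_finite_induct)
  case (insert x F)
  then show ?case
    by (simp add: circle_mean_add continuous_on_sum)
qed simp_all

text \<open>The real part of the Taylor polynomial of degree \<open>M\<close> of
  \<open>(1 - z) powr (-1/2)\<close>, evaluated at z = r e^(it).\<close>

definition cos_poly :: "real \<Rightarrow> nat \<Rightarrow> real \<Rightarrow> real" where
  "cos_poly r M t = (\<Sum>m\<le>M. beta m * r ^ m * cos (real m * t))"

text \<open>
  For \<open>m > 0\<close> these are the cosine coefficients of the convolution square of \<open>cos_poly\<close>, so that
  the energy kernel is \<open>C\<close> plus a nonnegative function.
\<close>

definition ker_coeff :: "real \<Rightarrow> real \<Rightarrow> nat \<Rightarrow> real" where
  "ker_coeff C r m = (if m = 0 then C + 1 else (beta m * r ^ m)\<^sup>2 / 2)"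

definition ker :: "real \<Rightarrow> real \<Rightarrow> nat \<Rightarrow> real \<Rightarrow> complex" where
  "ker C r M t = (\<Sum>m\<le>M. of_real (ker_coeff C r m) * cis (real m * t))"

lemma continuous_on_cos_poly [continuous_intros]:
  fixes f :: "'a::t2_space \<Rightarrow> real"
  shows "continuous_on S f \<Longrightarrow> continuous_on S (\<lambda>x. cos_poly r M (f x))"
  unfolding cos_poly_def by (intro continuous_intros)

lemma circle_mean_cos_mult_cos:
  "circle_mean (\<lambda>s. cos (real m * (a - s)) * cos (real l * (b - s)))
     = (if m = l then if m = 0 then 1 else cos (real m * (a - b)) / 2 else 0)"
proof -
  have eq: "cos (real m * (a - s)) * cos (real l * (b - s))
     = (1/2) * (cos ((real m * a - real l * b) + real_of_int (int l - int m) * s)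
        + cos ((real m * a + real l * b) + real_of_int (- (int m + int l)) * s))" for s
    unfolding cos_times_cos by (simp add: algebra_simps)
  have "circle_mean (\<lambda>s. cos (real m * (a - s)) * cos (real l * (b - s)))
     = (1/2) * ((if int l - int m = 0 then cos (real m * a - real l * b) else 0)
        + (if - (int m + int l) = 0 then cos (real m * a + real l * b) else 0))"
    unfolding eq
    by (subst circle_mean_cmult, intro continuous_intros, subst circle_mean_add)
       (intro continuous_intros | simp only: circle_mean_cos)+
  also have "\<dots> = (if m = l then if m = 0 then 1 else cos (real m * (a - b)) / 2 else 0)"
    by (auto simp: right_diff_distrib)
  finally show ?thesis .
qed

text \<open>Orthogonality removes the mixed terms. The identity serves twice: it turns energies into
  integrals of squares, and it makes the real part of the kernel nonnegative once
  \<open>cos_poly\<close> is.\<close>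

lemma circle_mean_cos_poly:
  "circle_mean (\<lambda>s. cos_poly r M (a - s) * cos_poly r M (b - s)) = Re (ker 0 r M (a - b))"
proof -
  define e where "e m = beta m * r ^ m" for m
  have "circle_mean (\<lambda>s. cos_poly r M (a - s) * cos_poly r M (b - s))
    = circle_mean (\<lambda>s. \<Sum>m\<le>M. \<Sum>l\<le>M. (e m * e l) * (cos (real m * (a - s)) * cos (real l * (b - s))))"
    by (simp add: cos_poly_def sum_product e_def mult_ac)
  also have "\<dots> = (\<Sum>m\<le>M. \<Sum>l\<le>M. circle_mean (\<lambda>s. (e m * e l) * (cos (real m * (a - s)) * cos (real l * (b - s)))))"
    by (subst circle_mean_sum, intro continuous_intros, intro sum.cong refl circle_mean_sum continuous_intros)
  also have "\<dots> = (\<Sum>m\<le>M. \<Sum>l\<le>M. (e m * e l) * (if m = l then if m = 0 then 1 else cos (real m * (a - b)) / 2 else 0))"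
    by (intro sum.cong refl) (subst circle_mean_cmult, intro continuous_intros, simp only: circle_mean_cos_mult_cos)
  also have "\<dots> = (\<Sum>m\<le>M. (e m * e m) * (if m = 0 then 1 else cos (real m * (a - b)) / 2))"
    by (intro sum.cong refl) (simp add: if_distrib[of "\<lambda>x. _ * x"] cong: if_cong)
  also have "\<dots> = Re (ker 0 r M (a - b))"
    unfolding ker_def Re_sum
    by (intro sum.cong refl) (auto simp: ker_coeff_def e_def power2_eq_square)
  finally show ?thesis .
qed

lemma Re_ker: "Re (ker C r M t) = C + Re (ker 0 r M t)"
proof -
  have "Re (ker C r M t) = (\<Sum>m\<le>M. (if m = 0 then C else 0) + ker_coeff 0 r m * cos (real m * t))"
    unfolding ker_def Re_sum by (intro sum.cong refl) (auto simp: ker_coeff_def)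
  then show ?thesis by (simp add: sum.distrib ker_def)
qed

lemma ker_minus: "ker C r M (- t) = cnj (ker C r M t)"
  by (simp add: ker_def cis_cnj)

lemma ker_coeff_pos: "0 < r \<Longrightarrow> 0 \<le> C \<Longrightarrow> 0 < ker_coeff C r m"
  using beta_pos[of m] by (auto simp: ker_coeff_def)

lemma coeff_square_le:
  assumes "0 < r" "r \<le> 1"
  shows "(beta m * r ^ m)\<^sup>2 * (real m + 1) \<le> 1"
proof -
  have "(r ^ m)\<^sup>2 \<le> 1" using assms by (simp add: power_le_one)
  then have "((beta m)\<^sup>2 * (real m + 1)) * (r ^ m)\<^sup>2 \<le> 1 * 1"
    by (intro mult_mono beta_square_le) auto
  then show ?thesis by (simp add: power_mult_distrib mult_ac)
qed

text \<open>The squared coefficient of a potential contains the kernel coefficient twice. By this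
  bound one of the two copies cancels the Dirichlet weight, and the other remains to form the
  energy.\<close>

lemma ker_coeff_le:
  assumes "0 < r" "r \<le> 1" "0 \<le> C"
  shows "(real m + 1) * ker_coeff C r m \<le> C + 1"
  using coeff_square_le[OF assms(1,2), of m] assms(3) by (auto simp: ker_coeff_def mult.commute)

text \<open>The term \<open>m = 0\<close> has no imaginary part, so the bound does not depend on
  \<open>C\<close>. The remaining coefficients are half of a decreasing sequence bounded by 1/m,
  whence half of 3.\<close>

lemma abs_Im_ker_le:
  assumes r: "0 < r" "r \<le> 1"
  shows "\<bar>Im (ker C r M t)\<bar> \<le> 3 / 2"
proof -
  define a where "a m = (beta m * r ^ m)\<^sup>2" for m
  have "\<bar>\<Sum>m=1..M. a m * sin (real m * t)\<bar> \<le> 3"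
  proof (rule abs_sine_series_le_3)
    fix m
    show "0 \<le> a m" by (simp add: a_def)
    have "a m * real m \<le> a m * (real m + 1)" by (intro mult_left_mono) (auto simp: a_def)
    then show "a m * real m \<le> 1" using coeff_square_le[OF r, of m] by (simp add: a_def)
    have "beta (Suc m) * r ^ Suc m \<le> beta m * r ^ m"
      using r beta_pos[of m] beta_pos[of "Suc m"]
      by (intro mult_mono beta_antimono power_decreasing) auto
    then show "a (Suc m) \<le> a m" unfolding a_def
      using r beta_pos[of "Suc m"]
      by (intro power_mono) (auto simp del: beta.simps intro!: mult_nonneg_nonneg less_imp_le)
  qed
  moreover have "Im (ker C r M t) = (\<Sum>m\<in>{1..M}. a m * sin (real m * t)) / 2"
  proof -
    have "Im (ker C r M t) = (\<Sum>m\<in>{..M}. ker_coeff C r m * sin (real m * t))"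
      by (simp add: ker_def)
    also have "\<dots> = (\<Sum>m\<in>{1..M}. ker_coeff C r m * sin (real m * t))"
      by (rule sum.mono_neutral_right) (auto simp: not_le)
    also have "\<dots> = (\<Sum>m\<in>{1..M}. a m * sin (real m * t) / 2)"
      by (intro sum.cong refl) (auto simp: ker_coeff_def a_def)
    finally show ?thesis by (simp add: sum_divide_distrib)
  qed
  ultimately show ?thesis by simp
qed

text \<open>Each factor is its real part times 1 + ix with
  \<open>\<bar>x\<bar> \<le> 1 / (4 n)\<close>, where n is the number of factors. The product of the
  n factors 1 + ix differs from 1 by at most exp(1/4) - 1, which is below 1/2.\<close>

lemma Re_prod_ge_half:
  fixes z :: "'i \<Rightarrow> complex"
  assumes I: "finite I" "I \<noteq> {}"
    and u: "\<And>i. i \<in> I \<Longrightarrow> 0 < Re (z i)"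
    and v: "\<And>i. i \<in> I \<Longrightarrow> 4 * real (card I) * \<bar>Im (z i)\<bar> \<le> Re (z i)"
  shows "Re (prod z I) \<ge> (1/2) * (\<Prod>i\<in>I. Re (z i))"
proof -
  define x where "x i = Im (z i) / Re (z i)" for i
  define n where "n = real (card I)"
  have n: "n > 0" using I by (simp add: n_def card_gt_0_iff)
  have z: "z i = of_real (Re (z i)) * (1 + \<i> * of_real (x i))" if "i \<in> I" for i
    using u[OF that] by (simp add: complex_eq_iff x_def)
  have x: "\<bar>x i\<bar> \<le> 1 / (4 * n)" if "i \<in> I" for i
    using u[OF that] v[OF that] n by (simp add: x_def n_def[symmetric] field_simps)
  obtain h where h: "bij_betw h {0..<card I} I" using ex_bij_betw_nat_finite[OF I(1)] by blast
  have "norm ((\<Prod>i\<in>I. 1 + \<i> * complex_of_real (x i)) - 1) \<le> (\<Prod>i\<in>I. 1 + norm (\<i> * complex_of_real (x i))) - 1"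
    using norm_prod_minus1_le_prod_minus1[of "\<lambda>k. \<i> * complex_of_real (x (h k))" "{0..<card I}"]
    unfolding prod.reindex_bij_betw[OF h, of "\<lambda>i. 1 + \<i> * complex_of_real (x i)"]
      prod.reindex_bij_betw[OF h, of "\<lambda>i. 1 + norm (\<i> * complex_of_real (x i))"] .
  also have "(\<Prod>i\<in>I. 1 + norm (\<i> * of_real (x i))) \<le> (\<Prod>i\<in>I. exp (1 / (4 * n)))"
  proof (rule prod_mono)
    fix i assume "i \<in> I"
    then have "1 + \<bar>x i\<bar> \<le> exp (1 / (4 * n))"
      using x[of i] exp_ge_add_one_self[of "1 / (4 * n)"] by linarith
    then show "0 \<le> 1 + norm (\<i> * of_real (x i)) \<and> 1 + norm (\<i> * of_real (x i)) \<le> exp (1 / (4 * n))"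
      by (simp add: norm_mult)
  qed
  also have "(\<Prod>i\<in>I. exp (1 / (4 * n))) = exp (1/4)"
    using n by (simp add: exp_of_nat_mult[symmetric] n_def[symmetric])
  also have "exp (1/4) - 1 \<le> (1/2 :: real)"
    using exp_bound[of "1/4"] by (simp add: power2_eq_square)
  finally have "cmod ((\<Prod>i\<in>I. 1 + \<i> * of_real (x i)) - 1) \<le> 1/2" by simp
  then have *: "1/2 \<le> Re (\<Prod>i\<in>I. 1 + \<i> * of_real (x i))"
    using abs_Re_le_cmod[of "(\<Prod>i\<in>I. 1 + \<i> * of_real (x i)) - 1"]
    unfolding minus_complex.sel one_complex.sel by linarith
  have "prod z I = (\<Prod>i\<in>I. of_real (Re (z i)) * (1 + \<i> * of_real (x i)))"
    by (rule prod.cong[OF refl]) (rule z)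
  also have "\<dots> = of_real (\<Prod>i\<in>I. Re (z i)) * (\<Prod>i\<in>I. 1 + \<i> * of_real (x i))"
    by (simp add: prod.distrib)
  finally have "Re (prod z I) = (\<Prod>i\<in>I. Re (z i)) * Re (\<Prod>i\<in>I. 1 + \<i> * of_real (x i))"
    by (simp only: Re_complex_of_real Im_complex_of_real times_complex.sel)
  moreover have "(\<Prod>i\<in>I. Re (z i)) * (1/2) \<le> (\<Prod>i\<in>I. Re (z i)) * Re (\<Prod>i\<in>I. 1 + \<i> * of_real (x i))"
    using u by (intro mult_left_mono * prod_nonneg) (auto intro: less_imp_le)
  ultimately show ?thesis by simp
qed

definition torus_ker :: "real \<Rightarrow> real \<Rightarrow> nat \<Rightarrow> real ^ 'n \<Rightarrow> complex" where
  "torus_ker C r M x = (\<Prod>j\<in>UNIV. ker C r M (x $ j))"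

definition torus_cos_poly :: "real \<Rightarrow> nat \<Rightarrow> real ^ 'n \<Rightarrow> real" where
  "torus_cos_poly r M x = (\<Prod>j\<in>UNIV. cos_poly r M (x $ j))"

lemma torus_integral_cos_poly:
  "(LINT \<psi>|torus_measure. torus_cos_poly r M (\<theta> - \<psi>) * torus_cos_poly r M (\<theta>' - \<psi>))
     = (\<Prod>j\<in>UNIV. Re (ker 0 r M ((\<theta> - \<theta>') $ j)))"
  unfolding torus_cos_poly_def prod.distrib[symmetric]
  using torus_integral_prod[of "\<lambda>j s. cos_poly r M (\<theta> $ j - s) * cos_poly r M (\<theta>' $ j - s)"]
  by (simp add: continuous_intros circle_mean_cos_poly)

lemma circle_mean_nonneg:
  fixes f :: "real \<Rightarrow> real"
  assumes "\<And>s. 0 \<le> f s"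
  shows "0 \<le> circle_mean f"
  unfolding circle_mean_def using assms by (intro scaleR_nonneg_nonneg integral_nonneg) auto

text \<open>The value of \<open>C\<close> is 4n times the bound 3/2 for the imaginary part, exactly
  the threshold required by \<open>Re_prod_ge_half\<close>. Since the real parts at
  \<open>C = 0\<close> are nonnegative, adding \<open>C\<close> to each only increases their
  product.\<close>

lemma Re_torus_ker_ge:
  fixes \<theta> \<theta>' :: "real ^ 'n"
  assumes r: "0 < r" "r \<le> 1" and C: "C = 6 * real CARD('n)"
    and pos: "\<And>t. 0 \<le> cos_poly r M t"
  shows "(1/2) * (LINT \<psi>|torus_measure. torus_cos_poly r M (\<theta> - \<psi>) * torus_cos_poly r M (\<theta>' - \<psi>))
    \<le> Re (torus_ker C r M (\<theta> - \<theta>'))"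
proof -
  have nn: "0 \<le> Re (ker 0 r M t)" for t
    using circle_mean_nonneg[of "\<lambda>s. cos_poly r M (t - s) * cos_poly r M (0 - s)"] pos
    unfolding circle_mean_cos_poly by simp
  have ge: "C \<le> Re (ker C r M t)" for t using nn[of t] by (simp add: Re_ker[of C])
  have Cpos: "0 < C" using C by simp
  have "(\<Prod>j\<in>UNIV. Re (ker 0 r M ((\<theta> - \<theta>') $ j))) \<le> (\<Prod>j\<in>UNIV. Re (ker C r M ((\<theta> - \<theta>') $ j)))"
    using nn Cpos by (intro prod_mono) (auto simp: Re_ker[of C])
  moreover have "(1/2) * (\<Prod>j\<in>UNIV. Re (ker C r M ((\<theta> - \<theta>') $ j))) \<le> Re (torus_ker C r M (\<theta> - \<theta>'))"
    unfolding torus_ker_def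
  proof (rule Re_prod_ge_half)
    fix j
    show "0 < Re (ker C r M ((\<theta> - \<theta>') $ j))" using ge Cpos less_le_trans by blast
    have "4 * real CARD('n) * \<bar>Im (ker C r M ((\<theta> - \<theta>') $ j))\<bar> \<le> 4 * real CARD('n) * (3 / 2)"
      by (intro mult_left_mono abs_Im_ker_le r) auto
    also have "\<dots> = C" by (simp add: C)
    finally show "4 * real CARD('n) * \<bar>Im (ker C r M ((\<theta> - \<theta>') $ j))\<bar> \<le> Re (ker C r M ((\<theta> - \<theta>') $ j))"
      using ge order.trans by blast
  qed auto
  ultimately show ?thesis by (simp add: torus_integral_cos_poly)
qed

section \<open>Expansion of product kernels over boxes of frequencies\<close>

lemma sum_box_prod:
  fixes f :: "'n::finite \<Rightarrow> nat \<Rightarrow> 'a::comm_semiring_1"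
  shows "(\<Sum>\<alpha> | \<forall>j. \<alpha> j \<le> M. \<Prod>j\<in>UNIV. f j (\<alpha> j)) = (\<Prod>j\<in>UNIV. \<Sum>m\<le>M. f j m)"
proof -
  have "{\<alpha>. \<forall>j. \<alpha> j \<le> M} = PiE (UNIV :: 'n set) (\<lambda>_. {..M})"
    by (auto simp: PiE_UNIV_domain Pi_def)
  then show ?thesis by (simp add: prod_sum_PiE)
qed

lemma cis_sum: "cis (\<Sum>j\<in>J. f j) = (\<Prod>j\<in>J. cis (f j))"
proof (induction J rule: infinite_finite_induct)
  case (insert x J)
  then show ?case by (simp add: cis_mult insert.IH[symmetric])
qed simp_all

lemma torus_ker_expand:
  fixes x :: "real ^ 'n"
  shows "torus_ker C r M x = (\<Sum>\<alpha> | \<forall>j. \<alpha> j \<le> M.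
    of_real (\<Prod>j\<in>UNIV. ker_coeff C r (\<alpha> j)) * cis (\<Sum>j\<in>UNIV. real (\<alpha> j) * x $ j))"
proof -
  have "torus_ker C r M x = (\<Sum>\<alpha> | \<forall>j. \<alpha> j \<le> M. \<Prod>j\<in>UNIV. of_real (ker_coeff C r (\<alpha> j)) * cis (real (\<alpha> j) * x $ j))"
    unfolding torus_ker_def ker_def
    by (rule sum_box_prod[where f = "\<lambda>j m. of_real (ker_coeff C r m) * cis (real m * x $ j)", symmetric])
  then show ?thesis by (simp add: prod.distrib cis_sum)
qed

lemma torus_ker_minus: "torus_ker C r M (- x) = cnj (torus_ker C r M x)"
  by (simp add: torus_ker_def ker_minus)

lemma integrable_torus_bounded:
  fixes f :: "real ^ 'n \<Rightarrow> 'b::{banach, second_countable_topology}"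
  assumes "f \<in> borel_measurable borel" "\<And>x. norm (f x) \<le> B"
  shows "integrable torus_measure f"
  using assms
  by (intro finite_measure.integrable_const_bound[OF finite_measure_torus_measure, of f B]
      borel_measurable_torus_measure) auto

lemma torus_cos_poly_measurable [measurable]: "torus_cos_poly r M \<in> borel_measurable borel"
proof -
  have [measurable]: "cos_poly r M \<in> borel_measurable borel"
    by (intro borel_measurable_continuous_onI continuous_intros)
  show ?thesis unfolding torus_cos_poly_def by measurable
qed

lemma torus_cos_poly_bounded: "\<exists>B. \<forall>x :: real ^ 'n. \<bar>torus_cos_poly r M x\<bar> \<le> B"
proof -
  define b where "b = (\<Sum>m\<le>M. \<bar>beta m * r ^ m\<bar>)"
  have "\<bar>cos_poly r M t\<bar> \<le> b" for t
    unfolding cos_poly_def b_def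
    by (rule order.trans[OF sum_abs sum_mono]) (simp add: abs_mult mult_left_le)
  then have "\<bar>torus_cos_poly r M x\<bar> \<le> b ^ CARD('n)" for x :: "real ^ 'n"
    unfolding torus_cos_poly_def abs_prod
    using prod_mono[of UNIV "\<lambda>j. \<bar>cos_poly r M (x $ j)\<bar>" "\<lambda>_. b"] by simp
  then show ?thesis by blast
qed

text \<open>In each variable, the modulus of 1 - r e^(it) is at most that of 1 - e^(it) plus 1 - r;
  the polynomial kernel thus dominates the regularized one at \<delta> = 1 - r, with a loss of 1/4
  per variable.\<close>

lemma torus_cos_poly_ge:
  fixes \<theta> \<psi> :: "real ^ 'n"
  assumes r: "0 < r" "r < 1"
    and p: "\<And>t. (1/4) / sqrt (cmod (1 - of_real r * cis t)) \<le> cos_poly r M t"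
  shows "(1/4) ^ CARD('n) * reg_kernel (1 - r) \<theta> \<psi> \<le> torus_cos_poly r M (\<theta> - \<psi>)"
proof -
  have "(1/4) * (1 / sqrt (cmod (cis a - cis b) + (1 - r))) \<le> cos_poly r M (a - b)" for a b
  proof -
    have "cmod (1 - of_real r * cis (a - b)) \<le> cmod (1 - cis (a - b)) + cmod (of_real (1 - r) * cis (a - b))"
      using norm_triangle_ineq[of "1 - cis (a - b)" "of_real (1 - r) * cis (a - b)"] by (simp add: algebra_simps)
    also have "cmod (of_real (1 - r) * cis (a - b)) = 1 - r" using r by (simp only: norm_mult norm_of_real norm_cis) simp
    also have "cmod (1 - cis (a - b)) = cmod (cis a - cis b)"
    proof -
      have "cis b * (1 - cis (a - b)) = cis b - cis a" by (simp add: right_diff_distrib cis_mult)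
      then have "cmod (cis b) * cmod (1 - cis (a - b)) = cmod (cis b - cis a)" by (metis norm_mult)
      then show ?thesis by (simp add: norm_minus_commute)
    qed
    finally have le: "cmod (1 - of_real r * cis (a - b)) \<le> cmod (cis a - cis b) + (1 - r)" .
    have "cmod (of_real r * cis (a - b)) < 1" using r by (simp add: norm_mult)
    then have "1 - of_real r * cis (a - b) \<noteq> 0" by auto
    then have "(1/4) / sqrt (cmod (cis a - cis b) + (1 - r)) \<le> (1/4) / sqrt (cmod (1 - of_real r * cis (a - b)))"
      using le by (intro divide_left_mono mult_pos_pos) (auto intro: less_le_trans[OF _ le])
    then show ?thesis using p[of "a - b"] by simp
  qed
  then have "(\<Prod>j\<in>UNIV. (1/4) * (1 / sqrt (cmod (cis (\<theta> $ j) - cis (\<psi> $ j)) + (1 - r)))) \<le> (\<Prod>j\<in>UNIV. cos_poly r M ((\<theta> - \<psi>) $ j))"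
    using r by (intro prod_mono) auto
  then show ?thesis by (simp only: torus_cos_poly_def reg_kernel_def prod.distrib prod_constant)
qed

text \<open>The duality inequality. With \<open>H\<close> the average of translates of
  \<open>torus_cos_poly\<close> by the weights \<open>c\<close>, the bound on the regularized
  potential gives \<open>q / 2 \<le> \<integral> H g\<close>, and Cauchy-Schwarz bounds the square
  of the right-hand side by \<eta> times \<open>\<integral> H\<^sup>2\<close>, which is the full
  energy of \<open>c\<close>.\<close>

lemma energy_lower_bound:
  fixes E :: "(real ^ 'n) set" and c :: "real ^ 'n \<Rightarrow> real"
  assumes r: "0 < r" "r < 1"
    and p: "\<And>t. (1/4) / sqrt (cmod (1 - of_real r * cis t)) \<le> cos_poly r M t"
    and g [measurable]: "g \<in> borel_measurable torus_measure"
    and \<eta>: "(\<integral>\<^sup>+ \<psi>. ennreal ((g \<psi>)\<^sup>2) \<partial>torus_measure) \<le> ennreal \<eta>" "0 < \<eta>"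
    and pot: "\<And>\<theta>. \<theta> \<in> E \<Longrightarrow> ennreal (1/2) \<le> (\<integral>\<^sup>+ \<psi>. ennreal (reg_kernel (1 - r) \<theta> \<psi>) * ennreal (g \<psi>) \<partial>torus_measure)"
    and F: "finite F" "F \<subseteq> E" and c: "\<And>\<theta>. \<theta> \<in> F \<Longrightarrow> 0 \<le> c \<theta>" "sum c F = 1"
  shows "((1/4) ^ CARD('n) / 2)\<^sup>2 / \<eta>
    \<le> (\<Sum>\<theta>\<in>F. \<Sum>\<theta>'\<in>F. c \<theta> * c \<theta>' * (LINT \<psi>|torus_measure. torus_cos_poly r M (\<theta> - \<psi>) * torus_cos_poly r M (\<theta>' - \<psi>)))"
proof -
  define q where "q = (1/4 :: real) ^ CARD('n)"
  define H where "H \<psi> = (\<Sum>\<theta>\<in>F. c \<theta> * torus_cos_poly r M (\<theta> - \<psi>))" for \<psi>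
  have q0: "0 \<le> q" by (simp add: q_def)
  have Pnn: "0 \<le> torus_cos_poly r M x" for x :: "real ^ 'n"
    unfolding torus_cos_poly_def using p by (intro prod_nonneg ballI order.trans[OF _ p]) auto
  have Hnn: "0 \<le> H \<psi>" for \<psi> unfolding H_def using c Pnn by (intro sum_nonneg mult_nonneg_nonneg) auto
  obtain B where B: "\<And>x :: real ^ 'n. \<bar>torus_cos_poly r M x\<bar> \<le> B" using torus_cos_poly_bounded by blast
  have B0: "0 \<le> B" using B[of 0] by linarith
  have Pm [measurable]: "(\<lambda>\<psi>. torus_cos_poly r M (\<theta> - \<psi>)) \<in> borel_measurable borel" for \<theta> :: "real ^ 'n"
    by measurable
  have PPint: "integrable torus_measure (\<lambda>\<psi>. torus_cos_poly r M (\<theta> - \<psi>) * torus_cos_poly r M (\<theta>' - \<psi>))" for \<theta> \<theta>' :: "real ^ 'n"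
    by (rule integrable_torus_bounded[where B = "B * B"]) (auto simp: abs_mult intro!: mult_mono B B0)
  have H2: "(H \<psi>)\<^sup>2 = (\<Sum>\<theta>\<in>F. \<Sum>\<theta>'\<in>F. c \<theta> * c \<theta>' * (torus_cos_poly r M (\<theta> - \<psi>) * torus_cos_poly r M (\<theta>' - \<psi>)))" for \<psi>
    by (simp add: H_def power2_eq_square sum_product mult_ac)
  have H2int: "integrable torus_measure (\<lambda>\<psi>. (H \<psi>)\<^sup>2)"
    unfolding H2 by (intro Bochner_Integration.integrable_sum integrable_mult_right PPint)
  have H2eq: "(LINT \<psi>|torus_measure. (H \<psi>)\<^sup>2)
    = (\<Sum>\<theta>\<in>F. \<Sum>\<theta>'\<in>F. c \<theta> * c \<theta>' * (LINT \<psi>|torus_measure. torus_cos_poly r M (\<theta> - \<psi>) * torus_cos_poly r M (\<theta>' - \<psi>)))"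
    unfolding H2 by (simp add: Bochner_Integration.integral_sum PPint)
  have [measurable]: "H \<in> borel_measurable torus_measure"
    unfolding H_def by (rule borel_measurable_torus_measure) measurable
  have [measurable]: "reg_kernel (1 - r) \<theta> \<in> borel_measurable torus_measure" for \<theta> :: "real ^ 'n"
    by (rule borel_measurable_torus_measure) measurable
  have [measurable]: "(\<lambda>\<psi>. torus_cos_poly r M (\<theta> - \<psi>)) \<in> borel_measurable torus_measure" for \<theta> :: "real ^ 'n"
    by (rule borel_measurable_torus_measure) measurable
  \<comment> \<open>The mass 1 of \<open>c\<close> is distributed over \<open>F\<close> so that the
    lower bound for the potential can be used point by point.\<close>
  have "ennreal (q / 2) = (\<Sum>\<theta>\<in>F. ennreal (c \<theta>) * (ennreal q * ennreal (1/2)))"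
  proof -
    have "(\<Sum>\<theta>\<in>F. ennreal (c \<theta>) * (ennreal q * ennreal (1/2))) = (\<Sum>\<theta>\<in>F. ennreal (c \<theta> * (q / 2)))"
    proof (intro sum.cong refl)
      fix \<theta> assume "\<theta> \<in> F"
      then have "ennreal (c \<theta> * (q * (1/2))) = ennreal (c \<theta>) * ennreal (q * (1/2))"
        using c q0 by (intro ennreal_mult) auto
      moreover have "ennreal (q * (1/2)) = ennreal q * ennreal (1/2)"
        using q0 by (intro ennreal_mult) auto
      ultimately show "ennreal (c \<theta>) * (ennreal q * ennreal (1/2)) = ennreal (c \<theta> * (q / 2))" by simp
    qed
    also have "\<dots> = ennreal (\<Sum>\<theta>\<in>F. c \<theta> * (q / 2))"
      using c by (intro sum_ennreal) (simp add: q_def)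
    also have "(\<Sum>\<theta>\<in>F. c \<theta> * (q / 2)) = q / 2" unfolding sum_distrib_right[symmetric] using c by simp
    finally show ?thesis by (rule sym)
  qed
  also have "\<dots> \<le> (\<Sum>\<theta>\<in>F. ennreal (c \<theta>) * (\<integral>\<^sup>+ \<psi>. ennreal (torus_cos_poly r M (\<theta> - \<psi>)) * ennreal (g \<psi>) \<partial>torus_measure))"
  proof (intro sum_mono mult_left_mono)
    fix \<theta> assume "\<theta> \<in> F"
    then have "ennreal q * ennreal (1/2) \<le> ennreal q * (\<integral>\<^sup>+ \<psi>. ennreal (reg_kernel (1 - r) \<theta> \<psi>) * ennreal (g \<psi>) \<partial>torus_measure)"
      using F by (intro mult_left_mono pot) auto
    also have "\<dots> = (\<integral>\<^sup>+ \<psi>. ennreal q * (ennreal (reg_kernel (1 - r) \<theta> \<psi>) * ennreal (g \<psi>)) \<partial>torus_measure)"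
      by (rule nn_integral_cmult[symmetric]) measurable
    also have "\<dots> \<le> (\<integral>\<^sup>+ \<psi>. ennreal (torus_cos_poly r M (\<theta> - \<psi>)) * ennreal (g \<psi>) \<partial>torus_measure)"
    proof (rule nn_integral_mono)
      fix \<psi> :: "real ^ 'n"
      have "ennreal q * ennreal (reg_kernel (1 - r) \<theta> \<psi>) \<le> ennreal (torus_cos_poly r M (\<theta> - \<psi>))"
        using torus_cos_poly_ge[OF r p, of \<theta> \<psi>] by (subst ennreal_mult'[symmetric]) (auto simp: q_def intro: ennreal_leI)
      then show "ennreal q * (ennreal (reg_kernel (1 - r) \<theta> \<psi>) * ennreal (g \<psi>)) \<le> ennreal (torus_cos_poly r M (\<theta> - \<psi>)) * ennreal (g \<psi>)"
        unfolding mult.assoc[symmetric] by (rule mult_right_mono) simp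
    qed
    finally show "ennreal q * ennreal (1/2) \<le> (\<integral>\<^sup>+ \<psi>. ennreal (torus_cos_poly r M (\<theta> - \<psi>)) * ennreal (g \<psi>) \<partial>torus_measure)" .
  qed simp
  also have "\<dots> = (\<Sum>\<theta>\<in>F. (\<integral>\<^sup>+ \<psi>. ennreal (c \<theta>) * (ennreal (torus_cos_poly r M (\<theta> - \<psi>)) * ennreal (g \<psi>)) \<partial>torus_measure))"
    by (intro sum.cong refl nn_integral_cmult[symmetric]) measurable
  also have "\<dots> = (\<integral>\<^sup>+ \<psi>. (\<Sum>\<theta>\<in>F. ennreal (c \<theta>) * (ennreal (torus_cos_poly r M (\<theta> - \<psi>)) * ennreal (g \<psi>))) \<partial>torus_measure)"
    by (rule nn_integral_sum[symmetric]) measurable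
  also have "\<dots> = (\<integral>\<^sup>+ \<psi>. ennreal (H \<psi>) * ennreal (g \<psi>) \<partial>torus_measure)"
  proof (intro nn_integral_cong)
    fix \<psi> :: "real ^ 'n"
    have "(\<Sum>\<theta>\<in>F. ennreal (c \<theta>) * ennreal (torus_cos_poly r M (\<theta> - \<psi>))) = (\<Sum>\<theta>\<in>F. ennreal (c \<theta> * torus_cos_poly r M (\<theta> - \<psi>)))"
      using c Pnn by (intro sum.cong refl) (simp add: ennreal_mult)
    also have "\<dots> = ennreal (H \<psi>)" unfolding H_def using c Pnn by (intro sum_ennreal) auto
    finally show "(\<Sum>\<theta>\<in>F. ennreal (c \<theta>) * (ennreal (torus_cos_poly r M (\<theta> - \<psi>)) * ennreal (g \<psi>))) = ennreal (H \<psi>) * ennreal (g \<psi>)"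
      by (simp only: mult.assoc[symmetric] sum_distrib_right[symmetric])
  qed
  finally have "ennreal (q / 2) \<le> (\<integral>\<^sup>+ \<psi>. ennreal (H \<psi>) * ennreal (g \<psi>) \<partial>torus_measure)" .
  then have "(ennreal (q / 2))\<^sup>2 \<le> (\<integral>\<^sup>+ \<psi>. ennreal (H \<psi>) * ennreal (g \<psi>) \<partial>torus_measure)\<^sup>2"
    by (rule power_mono) simp
  also have "\<dots> \<le> (\<integral>\<^sup>+ \<psi>. (ennreal (H \<psi>))\<^sup>2 \<partial>torus_measure) * (\<integral>\<^sup>+ \<psi>. (ennreal (g \<psi>))\<^sup>2 \<partial>torus_measure)"
    by (rule Cauchy_Schwarz_nn_integral) measurable
  also have "\<dots> \<le> ennreal (LINT \<psi>|torus_measure. (H \<psi>)\<^sup>2) * ennreal \<eta>"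
  proof (rule mult_mono)
    have "(\<integral>\<^sup>+ \<psi>. (ennreal (H \<psi>))\<^sup>2 \<partial>torus_measure) = (\<integral>\<^sup>+ \<psi>. ennreal ((H \<psi>)\<^sup>2) \<partial>torus_measure)"
      using Hnn by (simp add: ennreal_power)
    also have "\<dots> = ennreal (LINT \<psi>|torus_measure. (H \<psi>)\<^sup>2)"
      by (rule nn_integral_eq_integral[OF H2int]) simp
    finally show "(\<integral>\<^sup>+ \<psi>. (ennreal (H \<psi>))\<^sup>2 \<partial>torus_measure) \<le> ennreal (LINT \<psi>|torus_measure. (H \<psi>)\<^sup>2)" by simp
    \<comment> \<open>\<open>ennreal\<close> sends negative values of \<open>g\<close> to 0, so this
      is an inequality rather than an equality.\<close>
    have "(\<integral>\<^sup>+ \<psi>. (ennreal (g \<psi>))\<^sup>2 \<partial>torus_measure) \<le> (\<integral>\<^sup>+ \<psi>. ennreal ((g \<psi>)\<^sup>2) \<partial>torus_measure)"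
    proof (rule nn_integral_mono)
      fix \<psi> show "(ennreal (g \<psi>))\<^sup>2 \<le> ennreal ((g \<psi>)\<^sup>2)"
        by (cases "0 \<le> g \<psi>") (simp_all add: ennreal_power ennreal_neg)
    qed
    then show "(\<integral>\<^sup>+ \<psi>. (ennreal (g \<psi>))\<^sup>2 \<partial>torus_measure) \<le> ennreal \<eta>" using \<eta>(1) by (rule order.trans)
  qed auto
  finally have "ennreal ((q / 2)\<^sup>2) \<le> ennreal ((LINT \<psi>|torus_measure. (H \<psi>)\<^sup>2) * \<eta>)"
    using \<eta>(2) by (simp add: ennreal_power ennreal_mult q_def)
  then have "(q / 2)\<^sup>2 \<le> (LINT \<psi>|torus_measure. (H \<psi>)\<^sup>2) * \<eta>"
    using \<eta>(2) by (subst (asm) ennreal_le_iff) (auto intro!: mult_nonneg_nonneg)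
  then show ?thesis using \<eta>(2) by (simp only: H2eq[symmetric] q_def[symmetric] pos_divide_le_eq)
qed

subsection \<open>Small polynomials that are large on a null set\<close>

lemma exists_small_potential:
  fixes E :: "(real ^ 'n) set"
  assumes "capacity E = 0" "0 < \<eta>"
  shows "\<exists>g. g \<in> borel_measurable torus_measure \<and> (\<forall>\<theta>\<in>E. 1 \<le> potential g \<theta>) \<and>
    (\<integral>\<^sup>+ \<psi>. ennreal ((g \<psi>)\<^sup>2) \<partial>torus_measure) \<le> ennreal \<eta>"
proof -
  have "capacity E < ennreal \<eta>" using assms by simp
  then show ?thesis unfolding capacity_def INF_less_iff by (auto intro: less_imp_le)
qed

text \<open>Expanding the squared Fourier coefficients of the weights and summing over the box
  recovers the kernel at differences of points. It lets the energy that is bounded below also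
  compute the Dirichlet norm of the potential.\<close>

lemma energy_eq_sum_squares:
  fixes F :: "(real ^ 'n) set" and c :: "real ^ 'n \<Rightarrow> real"
  shows "(\<Sum>\<alpha> | \<forall>j. \<alpha> j \<le> M. (\<Prod>j\<in>UNIV. ker_coeff C r (\<alpha> j)) *
      (cmod (\<Sum>\<theta>\<in>F. of_real (c \<theta>) * cis (- (\<Sum>j\<in>UNIV. real (\<alpha> j) * \<theta> $ j))))\<^sup>2)
    = (\<Sum>\<theta>\<in>F. \<Sum>\<theta>'\<in>F. c \<theta> * c \<theta>' * Re (torus_ker C r M (\<theta> - \<theta>')))"
proof -
  define A where "A = {\<alpha> :: 'n \<Rightarrow> nat. \<forall>j. \<alpha> j \<le> M}"
  define K where "K \<alpha> = (\<Prod>j\<in>UNIV. ker_coeff C r (\<alpha> j))" for \<alpha> :: "'n \<Rightarrow> nat"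
  define e where "e \<alpha> x = (\<Sum>j\<in>UNIV. real (\<alpha> j) * (x :: real^'n) $ j)" for \<alpha> :: "'n \<Rightarrow> nat" and x
  have e_diff: "e \<alpha> (x - y) = e \<alpha> x - e \<alpha> y" for \<alpha> x y
    by (simp add: e_def right_diff_distrib sum_subtractf)
  have sq: "(cmod (\<Sum>\<theta>\<in>F. of_real (c \<theta>) * cis (- e \<alpha> \<theta>)))\<^sup>2
      = (\<Sum>\<theta>\<in>F. \<Sum>\<theta>'\<in>F. c \<theta> * c \<theta>' * Re (cis (e \<alpha> (\<theta> - \<theta>'))))" for \<alpha>
  proof -
    define s where "s = (\<Sum>\<theta>\<in>F. of_real (c \<theta>) * cis (- e \<alpha> \<theta>))"
    have "complex_of_real ((cmod s)\<^sup>2) = cnj s * s"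
      unfolding complex_norm_square by (rule mult.commute)
    also have "\<dots> = (\<Sum>\<theta>\<in>F. \<Sum>\<theta>'\<in>F. (of_real (c \<theta>) * cis (e \<alpha> \<theta>)) * (of_real (c \<theta>') * cis (- e \<alpha> \<theta>')))"
      by (simp add: s_def cis_cnj sum_product)
    also have "\<dots> = (\<Sum>\<theta>\<in>F. \<Sum>\<theta>'\<in>F. of_real (c \<theta> * c \<theta>') * cis (e \<alpha> (\<theta> - \<theta>')))"
    proof (intro sum.cong refl)
      fix \<theta> \<theta>'
      have "cis (e \<alpha> (\<theta> - \<theta>')) = cis (e \<alpha> \<theta>) * cis (- e \<alpha> \<theta>')"
        unfolding e_diff cis_mult by simp
      then show "(of_real (c \<theta>) * cis (e \<alpha> \<theta>)) * (of_real (c \<theta>') * cis (- e \<alpha> \<theta>')) = of_real (c \<theta> * c \<theta>') * cis (e \<alpha> (\<theta> - \<theta>'))"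
        by (simp only: of_real_mult mult_ac)
    qed
    finally have "Re (complex_of_real ((cmod s)\<^sup>2)) = (\<Sum>\<theta>\<in>F. \<Sum>\<theta>'\<in>F. Re (of_real (c \<theta> * c \<theta>') * cis (e \<alpha> (\<theta> - \<theta>'))))"
      by (simp only: Re_sum)
    then show ?thesis unfolding s_def by (simp only: Re_complex_of_real times_complex.sel Im_complex_of_real) simp
  qed
  have "(\<Sum>\<alpha>\<in>A. K \<alpha> * (cmod (\<Sum>\<theta>\<in>F. of_real (c \<theta>) * cis (- e \<alpha> \<theta>)))\<^sup>2)
    = (\<Sum>\<alpha>\<in>A. \<Sum>\<theta>\<in>F. \<Sum>\<theta>'\<in>F. c \<theta> * c \<theta>' * (K \<alpha> * Re (cis (e \<alpha> (\<theta> - \<theta>')))))"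
    unfolding sq sum_distrib_left by (intro sum.cong refl) (simp only: mult_ac)
  also have "\<dots> = (\<Sum>\<theta>\<in>F. \<Sum>\<theta>'\<in>F. \<Sum>\<alpha>\<in>A. c \<theta> * c \<theta>' * (K \<alpha> * Re (cis (e \<alpha> (\<theta> - \<theta>')))))"
    by (subst sum.swap, intro sum.cong refl, rule sum.swap)
  also have "\<dots> = (\<Sum>\<theta>\<in>F. \<Sum>\<theta>'\<in>F. c \<theta> * c \<theta>' * Re (torus_ker C r M (\<theta> - \<theta>')))"
  proof (intro sum.cong refl)
    fix \<theta> \<theta>'
    have "Re (torus_ker C r M (\<theta> - \<theta>')) = (\<Sum>\<alpha>\<in>A. K \<alpha> * Re (cis (e \<alpha> (\<theta> - \<theta>'))))"
      unfolding torus_ker_expand A_def[symmetric] K_def[symmetric] e_def[symmetric] Re_sum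
      by (intro sum.cong refl) simp
    then show "(\<Sum>\<alpha>\<in>A. c \<theta> * c \<theta>' * (K \<alpha> * Re (cis (e \<alpha> (\<theta> - \<theta>'))))) = c \<theta> * c \<theta>' * Re (torus_ker C r M (\<theta> - \<theta>'))"
      by (simp only: sum_distrib_left)
  qed
  finally show ?thesis by (simp only: A_def K_def e_def)
qed

text \<open>The convolution theorem for finitely supported weights: multiplying kernel coefficients
  by the Fourier coefficients of the weights gives the potential, a polynomial with frequencies in
  the box.\<close>

lemma sum_ker_translates:
  fixes x :: "real ^ 'n"
  shows "(\<Sum>\<alpha> | \<forall>j. \<alpha> j \<le> M. (of_real (\<Prod>j\<in>UNIV. ker_coeff C r (\<alpha> j)) *
      (\<Sum>\<theta>\<in>F. of_real (c \<theta>) * cis (- (\<Sum>j\<in>UNIV. real (\<alpha> j) * \<theta> $ j)))) * cis (\<Sum>j\<in>UNIV. real (\<alpha> j) * x $ j))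
    = (\<Sum>\<theta>\<in>F. of_real (c \<theta>) * torus_ker C r M (x - \<theta>))"
proof -
  define A where "A = {\<alpha> :: 'n \<Rightarrow> nat. \<forall>j. \<alpha> j \<le> M}"
  define K where "K \<alpha> = complex_of_real (\<Prod>j\<in>UNIV. ker_coeff C r (\<alpha> j))" for \<alpha> :: "'n \<Rightarrow> nat"
  define e where "e \<alpha> x = (\<Sum>j\<in>UNIV. real (\<alpha> j) * (x :: real^'n) $ j)" for \<alpha> :: "'n \<Rightarrow> nat" and x
  have e_diff: "e \<alpha> (x - y) = e \<alpha> x - e \<alpha> y" for \<alpha> x y
    by (simp add: e_def right_diff_distrib sum_subtractf)
  have "(\<Sum>\<alpha>\<in>A. (K \<alpha> * (\<Sum>\<theta>\<in>F. of_real (c \<theta>) * cis (- e \<alpha> \<theta>))) * cis (e \<alpha> x))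
    = (\<Sum>\<alpha>\<in>A. \<Sum>\<theta>\<in>F. of_real (c \<theta>) * (K \<alpha> * cis (e \<alpha> (x - \<theta>))))"
    unfolding sum_distrib_left sum_distrib_right
  proof (intro sum.cong refl)
    fix \<alpha> \<theta>
    have "cis (e \<alpha> (x - \<theta>)) = cis (- e \<alpha> \<theta>) * cis (e \<alpha> x)"
      unfolding e_diff cis_mult by simp
    then show "(K \<alpha> * (of_real (c \<theta>) * cis (- e \<alpha> \<theta>))) * cis (e \<alpha> x) = of_real (c \<theta>) * (K \<alpha> * cis (e \<alpha> (x - \<theta>)))"
      by (simp only: mult_ac)
  qed
  also have "\<dots> = (\<Sum>\<theta>\<in>F. \<Sum>\<alpha>\<in>A. of_real (c \<theta>) * (K \<alpha> * cis (e \<alpha> (x - \<theta>))))"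
    by (rule sum.swap)
  also have "\<dots> = (\<Sum>\<theta>\<in>F. of_real (c \<theta>) * torus_ker C r M (x - \<theta>))"
    unfolding torus_ker_expand A_def[symmetric] K_def[symmetric] e_def[symmetric] sum_distrib_left ..
  finally show ?thesis by (simp only: A_def K_def e_def)
qed

text \<open>A near minimizer of energy \<open>Q\<close> has potential with real part at least
  \<open>Q / 2\<close> on \<open>E\<close>, so scaling by \<open>2 / Q\<close> gives real part at
  least 1. The scaled potential has squared Dirichlet norm at most
  \<open>(4 W / Q\<^sup>2) * Q = 4 W / Q\<close>, and \<open>Q\<close> is as large as desired
  because the capacity vanishes.\<close>

lemma small_polynomial_large_on_null_set:
  fixes E :: "(real ^ 'n) set"
  assumes E: "torus_compact E" "capacity E = 0" and \<epsilon>: "0 < \<epsilon>"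
  shows "\<exists>M v. (\<Sum>\<alpha> | \<forall>j. \<alpha> j \<le> M. (\<Prod>j\<in>UNIV. real (\<alpha> j) + 1) * (cmod (v \<alpha>))\<^sup>2) \<le> \<epsilon> \<and>
    (\<forall>\<theta>\<in>E. 1 \<le> cmod (\<Sum>\<alpha> | \<forall>j. \<alpha> j \<le> M. v \<alpha> * cis (\<Sum>j\<in>UNIV. real (\<alpha> j) * \<theta> $ j)))"
proof (cases "E = {}")
  case True
  then show ?thesis using \<epsilon> by (intro exI[of _ 0] exI[of _ "\<lambda>_. 0"]) simp
next
  case False
  define C where "C = 6 * real CARD('n)"
  have C: "0 < C" by (simp add: C_def)
  define q where "q = ((1/4 :: real) ^ CARD('n) / 2)\<^sup>2"
  have q: "0 < q" by (simp add: q_def)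
  define W where "W = (C + 1) ^ CARD('n)"
  have W: "0 < W" using C by (simp add: W_def)
  \<comment> \<open>Solves \<open>4 * W / (q / (2 * \<eta>)) = \<epsilon>\<close>, where
    \<open>q / (2 * \<eta>)\<close> is the lower bound for the analytic energy:
    \<open>q / \<eta>\<close> from duality, halved on passing to the real part of the analytic
    kernel.\<close>
  define \<eta> where "\<eta> = \<epsilon> * q / (8 * W)"
  have \<eta>: "0 < \<eta>" using \<epsilon> q W by (simp add: \<eta>_def)
  obtain g where g: "g \<in> borel_measurable torus_measure" and pot: "\<And>\<theta>. \<theta> \<in> E \<Longrightarrow> 1 \<le> potential g \<theta>"
    and gn: "(\<integral>\<^sup>+ \<psi>. ennreal ((g \<psi>)\<^sup>2) \<partial>torus_measure) \<le> ennreal \<eta>"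
    using exists_small_potential[OF E(2) \<eta>] by blast
  obtain \<delta> where \<delta>: "0 < \<delta>" "\<delta> < 1"
    and reg: "\<And>\<theta>. \<theta> \<in> E \<Longrightarrow> ennreal (1/2) \<le> (\<integral>\<^sup>+ \<psi>. ennreal (reg_kernel \<delta> \<theta> \<psi>) * ennreal (g \<psi>) \<partial>torus_measure)"
    using reg_potential_uniform[OF E(1) g pot] by blast
  define r where "r = 1 - \<delta>"
  have r: "0 < r" "r < 1" "r \<le> 1" and \<delta>r: "\<delta> = 1 - r" using \<delta> by (simp_all add: r_def)
  obtain M where p: "\<And>t. (1/4) / sqrt (cmod (1 - of_real r * cis t)) \<le> cos_poly r M t"
    using cos_sum_beta_ge[of r] r unfolding cos_poly_def by (auto intro: less_imp_le)
  have p0: "0 \<le> cos_poly r M t" for t by (rule order.trans[OF _ p]) simp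
  define G where "G \<theta> \<theta>' = Re (torus_ker C r M (\<theta> - \<theta>'))" for \<theta> \<theta>' :: "real ^ 'n"
  have Gsym: "G \<theta> \<theta>' = G \<theta>' \<theta>" for \<theta> \<theta>'
    using torus_ker_minus[of C r M "\<theta>' - \<theta>"] by (simp add: G_def)
  have Q_ge: "q / (2 * \<eta>) \<le> (\<Sum>\<theta>\<in>F. \<Sum>\<theta>'\<in>F. c \<theta> * c \<theta>' * G \<theta> \<theta>')"
    if F: "finite F" "F \<subseteq> E" "\<forall>\<theta>\<in>F. 0 \<le> c \<theta>" "sum c F = 1" for F c
  proof -
    define L where "L \<theta> \<theta>' = (LINT \<psi>|torus_measure. torus_cos_poly r M (\<theta> - \<psi>) * torus_cos_poly r M (\<theta>' - \<psi>))" for \<theta> \<theta>' :: "real ^ 'n"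
    have "q / \<eta> \<le> (\<Sum>\<theta>\<in>F. \<Sum>\<theta>'\<in>F. c \<theta> * c \<theta>' * L \<theta> \<theta>')"
      unfolding q_def L_def
      by (rule energy_lower_bound[OF r(1,2) p g gn \<eta> reg[unfolded \<delta>r] F(1,2)]) (use F in auto)
    then have "q / (2 * \<eta>) \<le> (1/2) * (\<Sum>\<theta>\<in>F. \<Sum>\<theta>'\<in>F. c \<theta> * c \<theta>' * L \<theta> \<theta>')" by simp
    also have "\<dots> = (\<Sum>\<theta>\<in>F. \<Sum>\<theta>'\<in>F. c \<theta> * c \<theta>' * ((1/2) * L \<theta> \<theta>'))"
      unfolding sum_distrib_left by (intro sum.cong refl) (simp only: mult_ac)
    also have "\<dots> \<le> (\<Sum>\<theta>\<in>F. \<Sum>\<theta>'\<in>F. c \<theta> * c \<theta>' * G \<theta> \<theta>')"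
      unfolding L_def G_def
      using F r by (intro sum_mono mult_left_mono Re_torus_ker_ge p0 C_def mult_nonneg_nonneg) auto
    finally show ?thesis .
  qed
  have "0 < q / (2 * \<eta>)" using q \<eta> by simp
  moreover have "G i i \<le> Re (torus_ker C r M (0 :: real ^ 'n))" for i by (simp add: G_def)
  ultimately have "\<exists>F c. (F, c) \<in> {(F, c). finite F \<and> F \<subseteq> E \<and> (\<forall>i\<in>F. 0 \<le> c i) \<and> sum c F = 1} \<and>
      (\<forall>j\<in>E. (\<Sum>i\<in>F. \<Sum>j\<in>F. c i * c j * G i j) \<le> 2 * (\<Sum>i\<in>F. c i * G i j))"
    by (intro kernel_near_minimizer[where I = "q / (2 * \<eta>)" and R = "Re (torus_ker C r M (0 :: real ^ 'n))"] Gsym False)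
       (use Q_ge in auto)
  then obtain F c where F: "finite F" "F \<subseteq> E" "\<forall>\<theta>\<in>F. 0 \<le> c \<theta>" "sum c F = 1"
    and min: "\<And>\<theta>. \<theta> \<in> E \<Longrightarrow> (\<Sum>i\<in>F. \<Sum>j\<in>F. c i * c j * G i j) \<le> 2 * (\<Sum>i\<in>F. c i * G i \<theta>)"
    by blast
  define Q where "Q = (\<Sum>i\<in>F. \<Sum>j\<in>F. c i * c j * G i j)"
  have Qge: "q / (2 * \<eta>) \<le> Q" unfolding Q_def by (rule Q_ge[OF F])
  then have Q: "0 < Q" using \<open>0 < q / (2 * \<eta>)\<close> by linarith
  define A where "A = {\<alpha> :: 'n \<Rightarrow> nat. \<forall>j. \<alpha> j \<le> M}"
  define K where "K \<alpha> = (\<Prod>j\<in>UNIV. ker_coeff C r (\<alpha> j))" for \<alpha> :: "'n \<Rightarrow> nat"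
  define s where "s \<alpha> = (\<Sum>\<theta>\<in>F. of_real (c \<theta>) * cis (- (\<Sum>j\<in>UNIV. real (\<alpha> j) * \<theta> $ j)))" for \<alpha> :: "'n \<Rightarrow> nat"
  define v where "v \<alpha> = of_real (2 / Q) * (of_real (K \<alpha>) * s \<alpha>)" for \<alpha>
  have "1 \<le> cmod (\<Sum>\<alpha>\<in>A. v \<alpha> * cis (\<Sum>j\<in>UNIV. real (\<alpha> j) * \<theta> $ j))" if \<theta>: "\<theta> \<in> E" for \<theta>
  proof -
    have "(\<Sum>\<alpha>\<in>A. v \<alpha> * cis (\<Sum>j\<in>UNIV. real (\<alpha> j) * \<theta> $ j))
        = of_real (2 / Q) * (\<Sum>\<alpha>\<in>A. (of_real (K \<alpha>) * s \<alpha>) * cis (\<Sum>j\<in>UNIV. real (\<alpha> j) * \<theta> $ j))"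
      unfolding v_def sum_distrib_left by (simp only: mult.assoc)
    also have "\<dots> = of_real (2 / Q) * (\<Sum>i\<in>F. of_real (c i) * torus_ker C r M (\<theta> - i))"
      unfolding A_def K_def s_def by (simp only: sum_ker_translates)
    finally have "Re (\<Sum>\<alpha>\<in>A. v \<alpha> * cis (\<Sum>j\<in>UNIV. real (\<alpha> j) * \<theta> $ j))
        = Re (of_real (2 / Q) * (\<Sum>i\<in>F. of_real (c i) * torus_ker C r M (\<theta> - i)))" by simp
    then have "Re (\<Sum>\<alpha>\<in>A. v \<alpha> * cis (\<Sum>j\<in>UNIV. real (\<alpha> j) * \<theta> $ j)) = (2 / Q) * (\<Sum>i\<in>F. c i * G \<theta> i)"
      by (simp add: G_def)
    also have "\<dots> \<ge> 1"
    proof -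
      have "(\<Sum>i\<in>F. c i * G \<theta> i) = (\<Sum>i\<in>F. c i * G i \<theta>)"
        by (intro sum.cong refl arg_cong2[where f = "(*)"] Gsym)
      then show ?thesis using min[OF \<theta>, folded Q_def] Q by (simp add: field_simps)
    qed
    finally show ?thesis using complex_Re_le_cmod order.trans by blast
  qed
  moreover have "(\<Sum>\<alpha>\<in>A. (\<Prod>j\<in>UNIV. real (\<alpha> j) + 1) * (cmod (v \<alpha>))\<^sup>2) \<le> \<epsilon>"
  proof -
    have K0: "0 \<le> K \<alpha>" for \<alpha>
      unfolding K_def using ker_coeff_pos[of r C] r C by (intro prod_nonneg) (auto intro: less_imp_le)
    have KW: "(\<Prod>j\<in>UNIV. real (\<alpha> j) + 1) * K \<alpha> \<le> W" for \<alpha>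
    proof -
      have "(\<Prod>j\<in>UNIV. (real (\<alpha> j) + 1) * ker_coeff C r (\<alpha> j)) \<le> (\<Prod>j\<in>(UNIV :: 'n set). C + 1)"
        using ker_coeff_le[of r C] ker_coeff_pos[of r C] r C
        by (intro prod_mono) (auto intro!: mult_nonneg_nonneg less_imp_le)
      then show ?thesis by (simp add: K_def W_def prod.distrib)
    qed
    have "(\<Prod>j\<in>UNIV. real (\<alpha> j) + 1) * (cmod (v \<alpha>))\<^sup>2 \<le> (4 * W / Q\<^sup>2) * (K \<alpha> * (cmod (s \<alpha>))\<^sup>2)" for \<alpha>
    proof -
      have "(\<Prod>j\<in>UNIV. real (\<alpha> j) + 1) * (cmod (v \<alpha>))\<^sup>2
          = ((\<Prod>j\<in>UNIV. real (\<alpha> j) + 1) * K \<alpha>) * ((4 / Q\<^sup>2) * (K \<alpha> * (cmod (s \<alpha>))\<^sup>2))"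
        using K0[of \<alpha>] Q by (simp add: v_def norm_mult norm_divide power_mult_distrib power_divide power2_eq_square)
      also have "\<dots> \<le> W * ((4 / Q\<^sup>2) * (K \<alpha> * (cmod (s \<alpha>))\<^sup>2))"
        using K0 by (intro mult_right_mono KW) auto
      finally show ?thesis by (simp add: mult_ac)
    qed
    then have "(\<Sum>\<alpha>\<in>A. (\<Prod>j\<in>UNIV. real (\<alpha> j) + 1) * (cmod (v \<alpha>))\<^sup>2) \<le> (\<Sum>\<alpha>\<in>A. (4 * W / Q\<^sup>2) * (K \<alpha> * (cmod (s \<alpha>))\<^sup>2))"
      by (intro sum_mono)
    also have "\<dots> = (4 * W / Q\<^sup>2) * Q"
      unfolding sum_distrib_left[symmetric] A_def K_def s_def energy_eq_sum_squares
      by (simp add: Q_def G_def)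
    also have "\<dots> = 4 * W / Q" using Q by (simp add: power2_eq_square)
    also have "\<dots> \<le> 4 * W / (q / (2 * \<eta>))"
      using Qge Q W q \<eta> by (intro divide_left_mono) auto
    also have "\<dots> = \<epsilon>" using q W \<epsilon> by (simp add: \<eta>_def)
    finally show ?thesis .
  qed
  ultimately show ?thesis unfolding A_def by blast
qed

subsection \<open>Fourier series with disjoint blocks\<close>

definition trig_poly :: "('n \<Rightarrow> nat) set \<Rightarrow> (('n \<Rightarrow> nat) \<Rightarrow> complex) \<Rightarrow> real ^ 'n \<Rightarrow> complex" where
  "trig_poly A b \<theta> = (\<Sum>\<alpha>\<in>A. b \<alpha> * cis (\<Sum>j\<in>UNIV. real (\<alpha> j) * \<theta> $ j))"

lemma borel_measurable_cis_linear [measurable]: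
  "(\<lambda>\<theta> :: real ^ 'n. cis (\<Sum>j\<in>UNIV. c j * \<theta> $ j)) \<in> borel_measurable borel"
proof -
  have [measurable]: "cis \<in> borel_measurable borel"
    by (intro borel_measurable_continuous_onI continuous_intros)
  show ?thesis by measurable
qed

lemma integrable_cis_linear:
  "integrable torus_measure (\<lambda>\<theta> :: real ^ 'n. cis (\<Sum>j\<in>UNIV. c j * \<theta> $ j))"
  by (rule integrable_torus_bounded[where B = 1]) simp_all

lemma integrable_mult_cis_linear:
  fixes f :: "real ^ 'n \<Rightarrow> complex"
  assumes "integrable torus_measure f"
  shows "integrable torus_measure (\<lambda>\<theta>. f \<theta> * cis (\<Sum>j\<in>UNIV. c j * \<theta> $ j))"
proof (rule Bochner_Integration.integrable_bound[OF assms])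
  show "(\<lambda>\<theta>. f \<theta> * cis (\<Sum>j\<in>UNIV. c j * \<theta> $ j)) \<in> borel_measurable torus_measure"
    by (intro borel_measurable_times borel_measurable_integrable[OF assms]
        borel_measurable_integrable[OF integrable_cis_linear])
qed (simp add: norm_mult)

lemma integrable_trig_poly: "integrable torus_measure (trig_poly A b)"
  unfolding trig_poly_def by (intro Bochner_Integration.integrable_sum integrable_mult_right integrable_cis_linear)

lemma cis_neg_freq:
  "cis (- (\<Sum>j\<in>UNIV. real_of_int (k j) * \<theta> $ j)) = cis (\<Sum>j\<in>UNIV. - real_of_int (k j) * \<theta> $ j)"
  by (simp add: sum_negf)

text \<open>Orthogonality of characters. Since \<open>nat\<close> sends negative integers to 0, the
  sign condition on \<open>k\<close> has to accompany membership in \<open>A\<close>.\<close>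

lemma fourier_coeff_trig_poly:
  fixes A :: "('n::finite \<Rightarrow> nat) set"
  assumes "finite A"
  shows "fourier_coeff (trig_poly A b) k
    = (if (\<forall>j. 0 \<le> k j) \<and> (\<lambda>j. nat (k j)) \<in> A then b (\<lambda>j. nat (k j)) else 0)"
proof -
  have "fourier_coeff (trig_poly A b) k
    = (LINT \<theta>|torus_measure. (\<Sum>\<alpha>\<in>A. b \<alpha> * cis (\<Sum>j\<in>UNIV. real_of_int (int (\<alpha> j) - k j) * (\<theta> :: real ^ 'n) $ j)))"
    unfolding fourier_coeff_def
  proof (rule Bochner_Integration.integral_cong[OF refl])
    fix \<theta> :: "real ^ 'n"
    have "cis (\<Sum>j\<in>UNIV. real (\<alpha> j) * \<theta> $ j) * cis (- (\<Sum>j\<in>UNIV. real_of_int (k j) * \<theta> $ j))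
        = cis (\<Sum>j\<in>UNIV. real_of_int (int (\<alpha> j) - k j) * \<theta> $ j)" for \<alpha> :: "'n \<Rightarrow> nat"
      by (simp add: cis_mult left_diff_distrib sum_subtractf)
    then show "trig_poly A b \<theta> * cis (- (\<Sum>j\<in>UNIV. real_of_int (k j) * \<theta> $ j))
      = (\<Sum>\<alpha>\<in>A. b \<alpha> * cis (\<Sum>j\<in>UNIV. real_of_int (int (\<alpha> j) - k j) * \<theta> $ j))"
      unfolding trig_poly_def sum_distrib_right mult.assoc by simp
  qed
  also have "\<dots> = (\<Sum>\<alpha>\<in>A. b \<alpha> * (LINT \<theta>|torus_measure. cis (\<Sum>j\<in>UNIV. real_of_int (int (\<alpha> j) - k j) * (\<theta> :: real ^ 'n) $ j)))"
    by (subst Bochner_Integration.integral_sum) (auto intro!: integrable_mult_right integrable_cis_linear)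
  also have "\<dots> = (\<Sum>\<alpha>\<in>A. if \<alpha> = (\<lambda>j. nat (k j)) \<and> (\<forall>j. 0 \<le> k j) then b \<alpha> else 0)"
  proof (rule sum.cong[OF refl])
    fix \<alpha>
    have "((\<lambda>j. int (\<alpha> j) - k j) = (\<lambda>_. 0)) \<longleftrightarrow> \<alpha> = (\<lambda>j. nat (k j)) \<and> (\<forall>j. 0 \<le> k j)"
      unfolding fun_eq_iff by (metis cancel_comm_monoid_add_class.diff_cancel eq_iff_diff_eq_0 int_nat_eq nat_int of_nat_0_le_iff)
    then show "b \<alpha> * (LINT \<theta>|torus_measure. cis (\<Sum>j\<in>UNIV. real_of_int (int (\<alpha> j) - k j) * (\<theta> :: real ^ 'n) $ j))
      = (if \<alpha> = (\<lambda>j. nat (k j)) \<and> (\<forall>j. 0 \<le> k j) then b \<alpha> else 0)"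
      unfolding torus_integral_cis by simp
  qed
  also have "\<dots> = (if (\<forall>j. 0 \<le> k j) \<and> (\<lambda>j. nat (k j)) \<in> A then b (\<lambda>j. nat (k j)) else 0)"
  proof (cases "\<forall>j. 0 \<le> k j")
    case True
    then show ?thesis using assms by simp
  next
    case False
    then show ?thesis by (simp only: simp_thms if_False sum.neutral_const)
  qed
  finally show ?thesis .
qed

text \<open>Only the conjugated factor of the squared modulus is expanded; each remaining integral
  is then literally a Fourier coefficient of the polynomial, which is already known.\<close>

lemma integral_norm_square_trig_poly:
  fixes A :: "('n::finite \<Rightarrow> nat) set"
  assumes "finite A"
  shows "integrable torus_measure (\<lambda>\<theta>. (cmod (trig_poly A b \<theta>))\<^sup>2)"
    and "(LINT \<theta>|torus_measure. (cmod (trig_poly A b \<theta>))\<^sup>2) = (\<Sum>\<alpha>\<in>A. (cmod (b \<alpha>))\<^sup>2)"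
proof -
  define t where "t \<beta> \<theta> = trig_poly A b \<theta> * cis (- (\<Sum>j\<in>UNIV. real_of_int (int (\<beta> j)) * \<theta> $ j))"
    for \<beta> :: "'n \<Rightarrow> nat" and \<theta> :: "real ^ 'n"
  have t: "integrable torus_measure (t \<beta>)" for \<beta>
    unfolding t_def cis_neg_freq by (intro integrable_mult_cis_linear integrable_trig_poly)
  have sq: "complex_of_real ((cmod (trig_poly A b \<theta>))\<^sup>2) = (\<Sum>\<beta>\<in>A. cnj (b \<beta>) * t \<beta> \<theta>)" for \<theta>
  proof -
    have "complex_of_real ((cmod (trig_poly A b \<theta>))\<^sup>2) = trig_poly A b \<theta> * cnj (trig_poly A b \<theta>)"
      by (rule complex_norm_square)
    also have "cnj (trig_poly A b \<theta>) = (\<Sum>\<beta>\<in>A. cnj (b \<beta>) * cis (- (\<Sum>j\<in>UNIV. real_of_int (int (\<beta> j)) * \<theta> $ j)))"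
      by (simp add: trig_poly_def cis_cnj)
    finally show ?thesis by (simp add: t_def sum_distrib_left mult_ac)
  qed
  have int: "integrable torus_measure (\<lambda>\<theta>. complex_of_real ((cmod (trig_poly A b \<theta>))\<^sup>2))"
    unfolding sq by (intro Bochner_Integration.integrable_sum integrable_mult_right t)
  from integrable_Re[OF int] show "integrable torus_measure (\<lambda>\<theta>. (cmod (trig_poly A b \<theta>))\<^sup>2)" by simp
  have "complex_of_real (LINT \<theta>|torus_measure. (cmod (trig_poly A b \<theta>))\<^sup>2) = (LINT \<theta>|torus_measure. (\<Sum>\<beta>\<in>A. cnj (b \<beta>) * t \<beta> \<theta>))"
    unfolding sq[symmetric] by (rule integral_complex_of_real[symmetric])
  also have "\<dots> = (\<Sum>\<beta>\<in>A. (LINT \<theta>|torus_measure. cnj (b \<beta>) * t \<beta> \<theta>))"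
    by (rule Bochner_Integration.integral_sum) (intro integrable_mult_right t)
  also have "\<dots> = (\<Sum>\<beta>\<in>A. cnj (b \<beta>) * (LINT \<theta>|torus_measure. t \<beta> \<theta>))"
    by simp
  also have "\<dots> = (\<Sum>\<beta>\<in>A. cnj (b \<beta>) * fourier_coeff (trig_poly A b) (\<lambda>j. int (\<beta> j)))"
    by (simp only: t_def fourier_coeff_def)
  also have "\<dots> = (\<Sum>\<beta>\<in>A. complex_of_real ((cmod (b \<beta>))\<^sup>2))"
    by (intro sum.cong refl) (simp add: fourier_coeff_trig_poly[OF assms] complex_norm_square mult.commute del: of_real_power)
  finally have "complex_of_real (LINT \<theta>|torus_measure. (cmod (trig_poly A b \<theta>))\<^sup>2) = complex_of_real (\<Sum>\<alpha>\<in>A. (cmod (b \<alpha>))\<^sup>2)"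
    by (simp only: of_real_sum)
  then show "(LINT \<theta>|torus_measure. (cmod (trig_poly A b \<theta>))\<^sup>2) = (\<Sum>\<alpha>\<in>A. (cmod (b \<alpha>))\<^sup>2)"
    by (simp only: of_real_eq_iff)
qed

text \<open>For T the modulus of the polynomial, the inequality
  \<open>(T - \<eta>)\<^sup>2 \<ge> 0\<close> gives
  \<open>T \<le> \<eta> / 2 + T\<^sup>2 / (2 * \<eta>)\<close> pointwise, and integrating over total
  mass 1 takes the place of Cauchy-Schwarz.\<close>

lemma integral_norm_trig_poly_le:
  fixes A :: "('n::finite \<Rightarrow> nat) set"
  assumes "finite A" "(\<Sum>\<alpha>\<in>A. (cmod (b \<alpha>))\<^sup>2) \<le> \<eta>\<^sup>2" "0 < \<eta>"
  shows "(LINT \<theta>|torus_measure. cmod (trig_poly A b \<theta>)) \<le> \<eta>"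
proof -
  let ?T = "\<lambda>\<theta>. cmod (trig_poly A b \<theta>)"
  note i2 = integral_norm_square_trig_poly[OF assms(1), of b]
  have c: "integrable (torus_measure :: (real^'n) measure) (\<lambda>_. \<eta> / 2)"
    by (rule integrable_torus_bounded[where B = "\<eta> / 2"]) (use assms in auto)
  have meas: "measure (torus_measure :: (real^'n) measure) torus = 1"
    by (simp add: measure_def emeasure_torus_measure_space)
  have "(LINT \<theta>|torus_measure. ?T \<theta>) \<le> (LINT \<theta>|torus_measure. \<eta> / 2 + (1 / (2 * \<eta>)) * (?T \<theta>)\<^sup>2)"
  proof (rule integral_mono)
    show "integrable torus_measure ?T" by (intro integrable_norm integrable_trig_poly)
    show "integrable torus_measure (\<lambda>\<theta>. \<eta> / 2 + (1 / (2 * \<eta>)) * (?T \<theta>)\<^sup>2)"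
      by (intro Bochner_Integration.integrable_add c integrable_mult_right i2(1))
    fix \<theta> :: "real ^ 'n"
    have "0 \<le> (?T \<theta> - \<eta>)\<^sup>2" by simp
    then show "?T \<theta> \<le> \<eta> / 2 + (1 / (2 * \<eta>)) * (?T \<theta>)\<^sup>2"
      using assms(3) by (simp add: power2_eq_square field_simps)
  qed
  also have "\<dots> = \<eta> / 2 + (1 / (2 * \<eta>)) * (\<Sum>\<alpha>\<in>A. (cmod (b \<alpha>))\<^sup>2)"
    by (subst Bochner_Integration.integral_add[OF c]) (simp_all add: i2 meas)
  also have "\<dots> \<le> \<eta> / 2 + (1 / (2 * \<eta>)) * \<eta>\<^sup>2"
    using assms by (intro add_left_mono mult_left_mono) auto
  also have "\<dots> = \<eta>" using assms by (simp add: power2_eq_square)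
  finally show ?thesis .
qed

text \<open>The \<open>L\<^sup>1\<close> norms of the blocks are summable, so the series converges
  absolutely almost everywhere and Fourier coefficients may be taken term by term. Where it fails to
  be summable, \<open>suminf\<close> has an unspecified value, but this happens only on a null
  set.\<close>

lemma has_fourier_series_suminf:
  fixes A :: "nat \<Rightarrow> ('n::finite \<Rightarrow> nat) set"
  assumes A: "\<And>k. finite (A k)"
    and b: "\<And>k. (\<Sum>\<alpha>\<in>A k. (cmod (b k \<alpha>))\<^sup>2) \<le> (e k)\<^sup>2" "\<And>k. 0 < e k" "summable e"
    and a: "\<And>\<alpha>. a \<alpha> = (\<Sum>k. if \<alpha> \<in> A k then b k \<alpha> else 0)"
  shows "has_fourier_series (\<lambda>\<theta>. \<Sum>k. trig_poly (A k) (b k) \<theta>) a"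
proof -
  define T where "T k = trig_poly (A k) (b k)" for k
  have T: "integrable torus_measure (T k)" for k unfolding T_def by (rule integrable_trig_poly)
  have Tn: "integrable torus_measure (\<lambda>\<theta>. cmod (T k \<theta>))" for k by (intro integrable_norm T)
  have Te: "(LINT \<theta>|torus_measure. cmod (T k \<theta>)) \<le> e k" for k
    unfolding T_def by (rule integral_norm_trig_poly_le[OF A b(1,2)])
  have sum_int: "summable (\<lambda>k. LINT \<theta>|torus_measure. cmod (T k \<theta>))"
    by (rule summable_comparison_test'[OF b(3), of 0]) (simp add: Te)
  have AE: "AE \<theta> in torus_measure. summable (\<lambda>k. cmod (T k \<theta>))"
  proof -
    have "(\<integral>\<^sup>+ \<theta>. (\<Sum>k. ennreal (cmod (T k \<theta>))) \<partial>torus_measure) = (\<Sum>k. \<integral>\<^sup>+ \<theta>. ennreal (cmod (T k \<theta>)) \<partial>torus_measure)"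
      by (rule nn_integral_suminf) (use borel_measurable_integrable[OF Tn] in simp)
    also have "\<dots> = (\<Sum>k. ennreal (LINT \<theta>|torus_measure. cmod (T k \<theta>)))"
      by (intro arg_cong[where f = suminf] ext nn_integral_eq_integral Tn) simp
    also have "\<dots> \<noteq> \<infinity>"
      using sum_int by (simp add: ennreal_suminf_neq_top)
    finally have "AE \<theta> in torus_measure. (\<Sum>k. ennreal (cmod (T k \<theta>))) \<noteq> \<infinity>"
      by (intro nn_integral_PInf_AE) (use borel_measurable_integrable[OF Tn] in simp_all)
    then show ?thesis by eventually_elim (rule summable_suminf_not_top, auto)
  qed
  have int: "integrable torus_measure (\<lambda>\<theta>. \<Sum>k. T k \<theta>)"
    by (rule integrable_suminf[OF T AE sum_int])
  have coeff: "fourier_coeff (\<lambda>\<theta>. \<Sum>k. T k \<theta>) q = (\<Sum>k. fourier_coeff (T k) q)" for q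
  proof -
    define c where "c \<theta> = cis (- (\<Sum>j\<in>UNIV. real_of_int (q j) * \<theta> $ j))" for \<theta> :: "real ^ 'n"
    have c: "integrable torus_measure (\<lambda>\<theta>. f \<theta> * c \<theta>)" if "integrable torus_measure f" for f
      unfolding c_def cis_neg_freq by (intro integrable_mult_cis_linear that)
    have nc: "cmod (z * c \<theta>) = cmod z" for z \<theta> by (simp add: c_def norm_mult)
    have AE': "AE \<theta> in torus_measure. summable (\<lambda>k. cmod (T k \<theta> * c \<theta>))"
      and sum': "summable (\<lambda>k. LINT \<theta>|torus_measure. cmod (T k \<theta> * c \<theta>))"
      unfolding nc by (fact AE, fact sum_int)
    have "fourier_coeff (\<lambda>\<theta>. \<Sum>k. T k \<theta>) q = (LINT \<theta>|torus_measure. (\<Sum>k. T k \<theta>) * c \<theta>)"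
      by (simp add: fourier_coeff_def c_def)
    also have "\<dots> = (LINT \<theta>|torus_measure. (\<Sum>k. T k \<theta> * c \<theta>))"
    proof (rule integral_cong_AE)
      show "(\<lambda>\<theta>. (\<Sum>k. T k \<theta>) * c \<theta>) \<in> borel_measurable torus_measure"
        by (rule borel_measurable_integrable[OF c[OF int]])
      show "(\<lambda>\<theta>. \<Sum>k. T k \<theta> * c \<theta>) \<in> borel_measurable torus_measure"
        by (rule borel_measurable_integrable[OF integrable_suminf[OF c[OF T] AE' sum']])
      show "AE \<theta> in torus_measure. (\<Sum>k. T k \<theta>) * c \<theta> = (\<Sum>k. T k \<theta> * c \<theta>)"
        using AE by eventually_elim (rule suminf_mult2, rule summable_norm_cancel)
    qed
    also have "\<dots> = (\<Sum>k. LINT \<theta>|torus_measure. T k \<theta> * c \<theta>)"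
      by (rule integral_suminf[OF c[OF T] AE' sum'])
    also have "\<dots> = (\<Sum>k. fourier_coeff (T k) q)" by (simp add: fourier_coeff_def c_def)
    finally show ?thesis .
  qed
  have "fourier_coeff (\<lambda>\<theta>. \<Sum>k. T k \<theta>) q = (if \<forall>j. 0 \<le> q j then a (\<lambda>j. nat (q j)) else 0)" for q
  proof (cases "\<forall>j. 0 \<le> q j")
    case True
    then show ?thesis unfolding coeff by (simp add: T_def fourier_coeff_trig_poly[OF A] a)
  next
    case False
    then show ?thesis
      unfolding coeff by (simp only: T_def fourier_coeff_trig_poly[OF A] simp_thms if_False suminf_zero)
  qed
  then show ?thesis using int unfolding has_fourier_series_def T_def by blast
qed

text \<open>In each coordinate, \<open>\<alpha> j + s + 1 \<le> (s + 1) * (\<alpha> j + 1)\<close>.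
  The factor is independent of \<open>M\<close> and \<open>v\<close>.\<close>

lemma shifted_weighted_sum:
  fixes v :: "('n::finite \<Rightarrow> nat) \<Rightarrow> complex"
  shows "(\<Sum>\<alpha> | \<forall>j. s \<le> \<alpha> j \<and> \<alpha> j \<le> s + M. (\<Prod>j\<in>UNIV. real (\<alpha> j) + 1) * (cmod (v (\<lambda>j. \<alpha> j - s)))\<^sup>2)
    \<le> (real s + 1) ^ CARD('n) * (\<Sum>\<alpha> | \<forall>j. \<alpha> j \<le> M. (\<Prod>j\<in>UNIV. real (\<alpha> j) + 1) * (cmod (v \<alpha>))\<^sup>2)"
proof -
  have bij: "bij_betw (\<lambda>\<alpha> j. \<alpha> j + s) {\<alpha> :: 'n \<Rightarrow> nat. \<forall>j. \<alpha> j \<le> M} {\<alpha>. \<forall>j. s \<le> \<alpha> j \<and> \<alpha> j \<le> s + M}"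
    by (rule bij_betwI[where g = "\<lambda>\<alpha> j. \<alpha> j - s"]) (auto simp: fun_eq_iff le_diff_conv add.commute)
  have "(\<Sum>\<alpha> | \<forall>j. s \<le> \<alpha> j \<and> \<alpha> j \<le> s + M. (\<Prod>j\<in>UNIV. real (\<alpha> j) + 1) * (cmod (v (\<lambda>j. \<alpha> j - s)))\<^sup>2)
    = (\<Sum>\<alpha> | \<forall>j. \<alpha> j \<le> M. (\<Prod>j\<in>UNIV. real (\<alpha> j + s) + 1) * (cmod (v \<alpha>))\<^sup>2)"
    by (subst sum.reindex_bij_betw[OF bij, symmetric]) simp
  also have "\<dots> \<le> (\<Sum>\<alpha> | \<forall>j. \<alpha> j \<le> M. (real s + 1) ^ CARD('n) * ((\<Prod>j\<in>UNIV. real (\<alpha> j) + 1) * (cmod (v \<alpha>))\<^sup>2))"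
  proof (rule sum_mono)
    fix \<alpha> :: "'n \<Rightarrow> nat"
    have "(\<Prod>j\<in>UNIV. real (\<alpha> j + s) + 1) \<le> (\<Prod>j\<in>UNIV. (real s + 1) * (real (\<alpha> j) + 1))"
      by (intro prod_mono) (simp add: algebra_simps)
    also have "\<dots> = (real s + 1) ^ CARD('n) * (\<Prod>j\<in>UNIV. real (\<alpha> j) + 1)"
      by (simp add: prod.distrib)
    finally show "(\<Prod>j\<in>UNIV. real (\<alpha> j + s) + 1) * (cmod (v \<alpha>))\<^sup>2
        \<le> (real s + 1) ^ CARD('n) * ((\<Prod>j\<in>UNIV. real (\<alpha> j) + 1) * (cmod (v \<alpha>))\<^sup>2)"
      unfolding mult.assoc[symmetric] by (rule mult_right_mono) simp
  qed
  finally show ?thesis by (simp only: sum_distrib_left)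
qed

text \<open>A diagonal shift multiplies the polynomial by a single character, which has modulus
  1.\<close>

lemma cmod_shifted_sum:
  fixes v :: "('n::finite \<Rightarrow> nat) \<Rightarrow> complex" and \<theta> :: "real ^ 'n"
  shows "cmod (\<Sum>\<alpha> | \<forall>j. s \<le> \<alpha> j \<and> \<alpha> j \<le> s + M. v (\<lambda>j. \<alpha> j - s) * cis (\<Sum>j\<in>UNIV. real (\<alpha> j) * \<theta> $ j))
    = cmod (\<Sum>\<alpha> | \<forall>j. \<alpha> j \<le> M. v \<alpha> * cis (\<Sum>j\<in>UNIV. real (\<alpha> j) * \<theta> $ j))"
proof -
  have bij: "bij_betw (\<lambda>\<alpha> j. \<alpha> j + s) {\<alpha> :: 'n \<Rightarrow> nat. \<forall>j. \<alpha> j \<le> M} {\<alpha>. \<forall>j. s \<le> \<alpha> j \<and> \<alpha> j \<le> s + M}"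
    by (rule bij_betwI[where g = "\<lambda>\<alpha> j. \<alpha> j - s"]) (auto simp: fun_eq_iff le_diff_conv add.commute)
  have "(\<Sum>\<alpha> | \<forall>j. s \<le> \<alpha> j \<and> \<alpha> j \<le> s + M. v (\<lambda>j. \<alpha> j - s) * cis (\<Sum>j\<in>UNIV. real (\<alpha> j) * \<theta> $ j))
    = (\<Sum>\<alpha> | \<forall>j. \<alpha> j \<le> M. v \<alpha> * cis (\<Sum>j\<in>UNIV. real (\<alpha> j + s) * \<theta> $ j))"
    by (subst sum.reindex_bij_betw[OF bij, symmetric]) simp
  also have "\<dots> = (\<Sum>\<alpha> | \<forall>j. \<alpha> j \<le> M. cis (\<Sum>j\<in>UNIV. real s * \<theta> $ j) * (v \<alpha> * cis (\<Sum>j\<in>UNIV. real (\<alpha> j) * \<theta> $ j)))"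
  proof (rule sum.cong[OF refl])
    fix \<alpha> :: "'n \<Rightarrow> nat"
    have "cis (\<Sum>j\<in>UNIV. real (\<alpha> j + s) * \<theta> $ j) = cis (\<Sum>j\<in>UNIV. real s * \<theta> $ j) * cis (\<Sum>j\<in>UNIV. real (\<alpha> j) * \<theta> $ j)"
      unfolding cis_mult sum.distrib[symmetric] by (simp add: algebra_simps)
    then show "v \<alpha> * cis (\<Sum>j\<in>UNIV. real (\<alpha> j + s) * \<theta> $ j)
      = cis (\<Sum>j\<in>UNIV. real s * \<theta> $ j) * (v \<alpha> * cis (\<Sum>j\<in>UNIV. real (\<alpha> j) * \<theta> $ j))"
      by (simp only: mult_ac)
  qed
  finally show ?thesis by (simp only: sum_distrib_left[symmetric] norm_mult norm_cis mult_1)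
qed

subsection \<open>Divergence\<close>

theorem theorem2:
  fixes E :: "(real ^ 'n) set"
  assumes "torus_compact E"
    and "capacity E = 0"
  shows "\<exists>f \<in> dirichlet_space. \<exists>a. has_fourier_series f a \<and>
           (\<forall>\<theta>\<in>E. \<not> pringsheim_convergent a \<theta>)"
proof -
  define w where "w \<alpha> = (\<Prod>j\<in>UNIV. real (\<alpha> j) + 1)" for \<alpha> :: "'n \<Rightarrow> nat"
  have w1: "1 \<le> w \<alpha>" for \<alpha> unfolding w_def by (rule prod_ge_1) simp
  \<comment> \<open>The guard \<open>0 < \<epsilon>\<close> makes \<open>P\<close> solvable for
    every real \<epsilon>, so that degree and polynomial become total functions of \<epsilon>,
    available to a recursion.\<close>
  define P where "P \<epsilon> M v \<longleftrightarrow> (0 < \<epsilon> \<longrightarrow> (\<Sum>\<alpha> | \<forall>j. \<alpha> j \<le> M. w \<alpha> * (cmod (v \<alpha>))\<^sup>2) \<le> \<epsilon> \<and>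
      (\<forall>\<theta>\<in>E. 1 \<le> cmod (\<Sum>\<alpha> | \<forall>j. \<alpha> j \<le> M. v \<alpha> * cis (\<Sum>j\<in>UNIV. real (\<alpha> j) * \<theta> $ j))))"
    for \<epsilon> :: real and M :: nat and v :: "('n \<Rightarrow> nat) \<Rightarrow> complex"
  have "\<forall>\<epsilon>. \<exists>M v. P \<epsilon> M v"
    using small_polynomial_large_on_null_set[OF assms] unfolding P_def w_def by blast
  then obtain deg poly where "\<forall>\<epsilon>. P \<epsilon> (deg \<epsilon>) (poly \<epsilon>)" by metis
  then have small: "(\<Sum>\<alpha> | \<forall>j. \<alpha> j \<le> deg \<epsilon>. w \<alpha> * (cmod (poly \<epsilon> \<alpha>))\<^sup>2) \<le> \<epsilon>"
    and large: "\<theta> \<in> E \<Longrightarrow> 1 \<le> cmod (\<Sum>\<alpha> | \<forall>j. \<alpha> j \<le> deg \<epsilon>. poly \<epsilon> \<alpha> * cis (\<Sum>j\<in>UNIV. real (\<alpha> j) * \<theta> $ j))"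
    if "0 < \<epsilon>" for \<epsilon> \<theta>
    using that unfolding P_def by blast+
  \<comment> \<open>The denominator pays in advance for a shift by s; the numerator is the square of
    the \<open>L\<^sup>1\<close> bound \<open>(1/2) ^ k\<close> for block k.\<close>
  define \<epsilon> where "\<epsilon> k s = ((1/2) ^ k)\<^sup>2 / (real s + 1) ^ CARD('n)" for k s :: nat
  have \<epsilon>: "0 < \<epsilon> k s" for k s by (simp add: \<epsilon>_def)
  \<comment> \<open>The start of block k depends only on earlier degrees, so the tolerance of block
    k may depend on \<open>S k\<close> without circularity. The final 1 keeps consecutive coordinate
    ranges disjoint.\<close>
  define S where "S = rec_nat 0 (\<lambda>k s. s + deg (\<epsilon> k s) + 1)"
  define M where "M k = deg (\<epsilon> k (S k))" for k
  have S_Suc: "S (Suc k) = S k + M k + 1" for k by (simp add: S_def M_def)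
  have S_step: "S k + M k < S l" if "k < l" for k l
    using that
  proof (induction l)
    case (Suc l)
    then show ?case by (cases "k = l") (auto simp: S_Suc)
  qed simp
  have S_ge: "k \<le> S k" for k by (induction k) (auto simp: S_Suc)
  define B where "B k = {\<alpha> :: 'n \<Rightarrow> nat. \<forall>j. S k \<le> \<alpha> j \<and> \<alpha> j \<le> S k + M k}" for k
  define b where "b k \<alpha> = poly (\<epsilon> k (S k)) (\<lambda>j. \<alpha> j - S k)" for k and \<alpha> :: "'n \<Rightarrow> nat"
  define a where "a \<alpha> = (\<Sum>k. if \<alpha> \<in> B k then b k \<alpha> else 0)" for \<alpha>
  have finB: "finite (B k)" for k
  proof (rule finite_subset)
    show "B k \<subseteq> PiE UNIV (\<lambda>_. {..S k + M k})" by (auto simp: B_def PiE_UNIV_domain)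
  qed (simp add: finite_PiE)
  have disj: "k = l" if "\<alpha> \<in> B k" "\<alpha> \<in> B l" for \<alpha> k l
  proof -
    have "\<not> k < l" if "\<alpha> \<in> B k" "\<alpha> \<in> B l" for k l
    proof
      assume "k < l"
      have "\<alpha> j \<le> S k + M k" "S l \<le> \<alpha> j" for j using that by (simp_all add: B_def)
      then show False using S_step[OF \<open>k < l\<close>] by (meson leD order.trans)
    qed
    then show ?thesis using that by (meson linorder_neqE_nat)
  qed
  have a_in: "a \<alpha> = b k \<alpha>" if "\<alpha> \<in> B k" for \<alpha> k
  proof -
    have "a \<alpha> = (\<Sum>l\<in>{k}. if \<alpha> \<in> B l then b l \<alpha> else 0)"
      unfolding a_def by (rule suminf_finite) (use disj that in auto)
    then show ?thesis using that by simp
  qed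
  have a_out: "a \<alpha> = 0" if "\<And>k. \<alpha> \<notin> B k" for \<alpha>
    unfolding a_def using that by simp
  have wB: "(\<Sum>\<alpha>\<in>B k. w \<alpha> * (cmod (b k \<alpha>))\<^sup>2) \<le> ((1/2) ^ k)\<^sup>2" for k
  proof -
    have "(\<Sum>\<alpha>\<in>B k. w \<alpha> * (cmod (b k \<alpha>))\<^sup>2)
        \<le> (real (S k) + 1) ^ CARD('n) * (\<Sum>\<alpha> | \<forall>j. \<alpha> j \<le> M k. w \<alpha> * (cmod (poly (\<epsilon> k (S k)) \<alpha>))\<^sup>2)"
      unfolding B_def b_def w_def by (rule shifted_weighted_sum)
    also have "\<dots> \<le> (real (S k) + 1) ^ CARD('n) * \<epsilon> k (S k)"
      unfolding M_def by (intro mult_left_mono small \<epsilon>) simp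
    also have "\<dots> = ((1/2) ^ k)\<^sup>2" by (simp add: \<epsilon>_def)
    finally show ?thesis .
  qed
  define f where "f \<theta> = (\<Sum>k. trig_poly (B k) (b k) \<theta>)" for \<theta>
  have fourier: "has_fourier_series f a"
    unfolding f_def
  proof (rule has_fourier_series_suminf[OF finB, where e = "\<lambda>k. (1/2) ^ k"])
    fix k
    have "(\<Sum>\<alpha>\<in>B k. (cmod (b k \<alpha>))\<^sup>2) \<le> (\<Sum>\<alpha>\<in>B k. w \<alpha> * (cmod (b k \<alpha>))\<^sup>2)"
    proof (rule sum_mono)
      fix \<alpha>
      show "(cmod (b k \<alpha>))\<^sup>2 \<le> w \<alpha> * (cmod (b k \<alpha>))\<^sup>2"
        using mult_right_mono[OF w1[of \<alpha>], of "(cmod (b k \<alpha>))\<^sup>2"] by simp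
    qed
    then show "(\<Sum>\<alpha>\<in>B k. (cmod (b k \<alpha>))\<^sup>2) \<le> ((1/2) ^ k)\<^sup>2" using wB[of k] by linarith
  qed (simp_all add: a_def)
  have "(\<lambda>\<alpha>. w \<alpha> * (cmod (a \<alpha>))\<^sup>2) summable_on UNIV"
  proof (rule nonneg_bounded_partial_sums_imp_summable_on)
    show "0 \<le> w \<alpha> * (cmod (a \<alpha>))\<^sup>2" for \<alpha> using w1[of \<alpha>] by simp
    have "(\<Sum>\<alpha>\<in>X. w \<alpha> * (cmod (a \<alpha>))\<^sup>2) \<le> 2" if X: "finite X" for X
    proof -
      \<comment> \<open>If \<alpha> lies in \<open>B k\<close>, then
        \<open>k \<le> S k \<le> \<alpha> j\<close> for every j; this crude total therefore bounds
        the index of every block that meets \<open>X\<close>.\<close>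
      define N where "N = (\<Sum>\<alpha>\<in>X. \<Sum>j\<in>UNIV. \<alpha> j)"
      define U where "U = (\<Union>k\<in>{..N}. B k)"
      have "(\<Sum>\<alpha>\<in>X. w \<alpha> * (cmod (a \<alpha>))\<^sup>2) = (\<Sum>\<alpha>\<in>X \<inter> U. w \<alpha> * (cmod (a \<alpha>))\<^sup>2)"
      proof (rule sum.mono_neutral_right[OF X])
        show "\<forall>\<alpha>\<in>X - X \<inter> U. w \<alpha> * (cmod (a \<alpha>))\<^sup>2 = 0"
        proof
          fix \<alpha> assume \<alpha>: "\<alpha> \<in> X - X \<inter> U"
          have "\<alpha> \<notin> B k" for k
          proof
            assume k: "\<alpha> \<in> B k"
            obtain j :: 'n where True by simp
            have "k \<le> \<alpha> j" using S_ge[of k] k by (auto simp: B_def intro: order.trans)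
            also have "\<dots> \<le> (\<Sum>j\<in>UNIV. \<alpha> j)" by (rule member_le_sum) auto
            also have "\<dots> \<le> N" unfolding N_def using \<alpha> X by (intro member_le_sum[of \<alpha> X "\<lambda>\<alpha>. \<Sum>j\<in>UNIV. \<alpha> j"]) auto
            finally show False using k \<alpha> by (auto simp: U_def)
          qed
          then show "w \<alpha> * (cmod (a \<alpha>))\<^sup>2 = 0" by (simp add: a_out)
        qed
      qed auto
      also have "\<dots> \<le> (\<Sum>\<alpha>\<in>U. w \<alpha> * (cmod (a \<alpha>))\<^sup>2)"
        using w1 by (intro sum_mono2) (auto simp: U_def finB intro!: mult_nonneg_nonneg intro: order.trans[OF zero_le_one])
      also have "\<dots> = (\<Sum>k\<le>N. \<Sum>\<alpha>\<in>B k. w \<alpha> * (cmod (a \<alpha>))\<^sup>2)"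
        unfolding U_def by (rule sum.UNION_disjoint) (use finB disj in auto)
      also have "\<dots> = (\<Sum>k\<le>N. \<Sum>\<alpha>\<in>B k. w \<alpha> * (cmod (b k \<alpha>))\<^sup>2)"
        by (intro sum.cong refl) (simp add: a_in)
      also have "\<dots> \<le> (\<Sum>k\<le>N. (1/2) ^ k)"
      proof (rule sum_mono)
        fix k
        have "((1/2 :: real) ^ k)\<^sup>2 \<le> (1/2) ^ k"
          unfolding power2_eq_square by (rule mult_left_le) (simp_all add: power_le_one)
        with wB[of k] show "(\<Sum>\<alpha>\<in>B k. w \<alpha> * (cmod (b k \<alpha>))\<^sup>2) \<le> (1/2) ^ k" by linarith
      qed
      also have "\<dots> \<le> (\<Sum>k. (1/2) ^ k)"
        by (rule sum_le_suminf) (simp_all add: summable_geometric)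
      also have "\<dots> = (2 :: real)" by (subst suminf_geometric) simp_all
      finally show ?thesis .
    qed
    then show "eventually (\<lambda>X. (\<Sum>\<alpha>\<in>X. w \<alpha> * (cmod (a \<alpha>))\<^sup>2) \<le> 2) (finite_subsets_at_top UNIV)"
      by (intro eventually_finite_subsets_at_top_weakI) auto
  qed
  then have "dirichlet_coeffs a" by (simp add: dirichlet_coeffs_def w_def)
  then have "f \<in> dirichlet_space" using fourier by (auto simp: dirichlet_space_def)
  moreover have "\<not> pringsheim_convergent a \<theta>" if \<theta>: "\<theta> \<in> E" for \<theta>
  proof
    assume "pringsheim_convergent a \<theta>"
    then obtain l where l: "(rect_partial_sum a \<theta> \<longlongrightarrow> l) (filtercomap (\<lambda>N. Min (range N)) at_top)"
      by (auto simp: pringsheim_convergent_def)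
    \<comment> \<open>Cubes ending exactly with block k. Their side is at least k, which makes them
      an admissible sequence for the Pringsheim limit.\<close>
    define N where "N k = (\<lambda>_ :: 'n. S k + M k)" for k
    have "filterlim N (filtercomap (\<lambda>N. Min (range N)) at_top) sequentially"
      unfolding filterlim_filtercomap_iff
    proof (rule filterlim_at_top_mono[OF filterlim_ident])
      show "\<forall>\<^sub>F k in sequentially. k \<le> ((\<lambda>N. Min (range N)) \<circ> N) k"
        using S_ge by (intro always_eventually allI) (simp add: N_def trans_le_add1)
    qed
    then have lim: "(\<lambda>k. rect_partial_sum a \<theta> (N k)) \<longlonglongrightarrow> l"
      using filterlim_compose[OF l] by blast
    then have "(\<lambda>k. rect_partial_sum a \<theta> (N (Suc k)) - rect_partial_sum a \<theta> (N k)) \<longlonglongrightarrow> l - l"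
      by (intro tendsto_diff LIMSEQ_Suc)
    moreover have "1 \<le> cmod (rect_partial_sum a \<theta> (N (Suc k)) - rect_partial_sum a \<theta> (N k))" for k
    proof -
      define e where "e \<alpha> = cis (\<Sum>j\<in>UNIV. real (\<alpha> j) * \<theta> $ j)" for \<alpha> :: "'n \<Rightarrow> nat"
      define R where "R k = {\<alpha> :: 'n \<Rightarrow> nat. \<forall>j. \<alpha> j \<le> S k + M k}" for k
      have finR: "finite (R k)" for k
      proof (rule finite_subset)
        show "R k \<subseteq> PiE UNIV (\<lambda>_. {..S k + M k})" by (auto simp: R_def PiE_UNIV_domain)
      qed (simp add: finite_PiE)
      have sub: "R k \<subseteq> R (Suc k)" by (auto simp: R_def S_Suc intro: le_trans)
      have "rect_partial_sum a \<theta> (N (Suc k)) - rect_partial_sum a \<theta> (N k) = (\<Sum>\<alpha>\<in>R (Suc k) - R k. a \<alpha> * e \<alpha>)"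
        unfolding rect_partial_sum_def N_def R_def[symmetric] e_def[symmetric]
        by (rule sum_diff[OF finR sub, symmetric])
      \<comment> \<open>The difference of two cubes is larger than the block when there are several
        variables, but \<open>a\<close> vanishes off the blocks. A frequency in this difference has
        some coordinate above \<open>S k + M k\<close>, which excludes blocks up to k, and all its
        coordinates are at most \<open>S (Suc k) + M (Suc k)\<close>, which excludes blocks after
        \<open>Suc k\<close>.\<close>
      also have "\<dots> = (\<Sum>\<alpha>\<in>B (Suc k). a \<alpha> * e \<alpha>)"
      proof (rule sum.mono_neutral_right)
        show "finite (R (Suc k) - R k)" using finR by simp
        show "B (Suc k) \<subseteq> R (Suc k) - R k"
        proof
          fix \<alpha> assume "\<alpha> \<in> B (Suc k)"
          then have \<alpha>: "S (Suc k) \<le> \<alpha> j" "\<alpha> j \<le> S (Suc k) + M (Suc k)" for j by (simp_all add: B_def)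
          \<comment> \<open>One coordinate suffices to leave the smaller cube;
            \<open>undefined\<close> names an arbitrary one, which exists because the dimension is
            at least 1.\<close>
          then have "\<not> \<alpha> undefined \<le> S k + M k"
            using S_step[of k "Suc k"] by (meson leD lessI less_le_trans)
          then have "\<alpha> \<notin> R k" unfolding R_def by blast
          moreover have "\<alpha> \<in> R (Suc k)" using \<alpha>(2) by (simp add: R_def)
          ultimately show "\<alpha> \<in> R (Suc k) - R k" by blast
        qed
        show "\<forall>\<alpha>\<in>R (Suc k) - R k - B (Suc k). a \<alpha> * e \<alpha> = 0"
        proof
          fix \<alpha> assume \<alpha>: "\<alpha> \<in> R (Suc k) - R k - B (Suc k)"
          have "\<alpha> \<notin> B l" for l
          proof
            assume l: "\<alpha> \<in> B l"
            obtain j where j: "S k + M k < \<alpha> j" using \<alpha> by (auto simp: R_def not_le)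
            have "\<not> l \<le> k"
            proof
              assume "l \<le> k"
              then have "S l + M l \<le> S k + M k" using S_step[of l k] by (cases "l = k") auto
              then show False using l j by (auto simp: B_def dest!: spec[of _ j])
            qed
            moreover have "\<not> Suc k < l"
            proof
              assume "Suc k < l"
              from S_step[OF this] have "\<alpha> j < S l" using \<alpha> by (auto simp: R_def intro: le_less_trans)
              then show False using l by (auto simp: B_def dest!: spec[of _ j])
            qed
            ultimately have "l = Suc k" by linarith
            then show False using l \<alpha> by simp
          qed
          then show "a \<alpha> * e \<alpha> = 0" by (simp add: a_out)
        qed
      qed
      also have "\<dots> = (\<Sum>\<alpha>\<in>B (Suc k). b (Suc k) \<alpha> * e \<alpha>)"
        by (intro sum.cong refl) (simp add: a_in)
      finally show ?thesis
        using large[OF \<epsilon> \<theta>, of "Suc k" "S (Suc k)"]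
        by (simp only: B_def b_def e_def cmod_shifted_sum M_def)
    qed
    ultimately have "1 \<le> cmod (l - l)"
      by (intro tendsto_lowerbound[OF tendsto_norm]) (auto intro: always_eventually)
    then show False by simp
  qed
  ultimately show ?thesis using fourier by blast
qed

end
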